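(* Let $R$ be a convex quadrilateral in the $xy$-plane which is not a trapezoid, and let $M_1, M_2$ be the unique pair of conjugate directions that belongs to all ellipses passing through the four vertices of $R$. Then there exists a unique ellipse $E_O$ which passes through the four vertices of $R$ and whose equal conjugate diameters possess the directional constants $M_1$ and $M_2$ (that is, which has a pair of conjugate diameters of equal length whose directions are $M_1$ and $M_2$). Furthermore, $E_O$ is the unique ellipse of minimal eccentricity among all ellipses which pass through the four vertices of $R$.
   Context: Ellipses are nondegenerate and include circles. If an ellipse has semi-major axis length $a$ and semi-minor axis length $b$ ($a\ge b>0$), its eccentricity is $\sqrt{1-b^2/a^2}$. A trapezoid is a convex quadrilateral with at least one pair of parallel sides. A diameter of an ellipse is a chord through its center. A pair of conjugate diameters of an ellipse are two diameters such that each bisects all chords drawn parallel to the other. If $\theta_1,\theta_2$ are the angles which a pair of conjugate diameters make with the positive $x$-axis, then $\tan\theta_1,\tan\theta_2$ (with the value $\infty$ for a vertical diameter) are called a pair of conjugate directions, or directional constants, of the ellipse, and one says that this pair belongs to the ellipse. It is a known result of Steiner that, for $R$ as in the claim, there is exactly one pair of conjugate directions $M_1, M_2$ that belongs to every ellipse passing through the four vertices of $R$. Equal conjugate diameters of an ellipse are a pair of conjugate diameters having the same length. *)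

theory Defs
  imports "HOL-Analysis.Analysis"
begin

section \<open>Ellipses\<close>

definition ellipse_with :: "(real^2) set \<Rightarrow> real^2 \<Rightarrow> real \<Rightarrow> real \<Rightarrow> bool" where
  "ellipse_with E c a b \<longleftrightarrow> a \<ge> b \<and> b > 0 \<and>
     (\<exists>u v. norm u = 1 \<and> norm v = 1 \<and> u \<bullet> v = 0 \<and>
        E = {p. (u \<bullet> (p - c) / a)\<^sup>2 + (v \<bullet> (p - c) / b)\<^sup>2 = 1})"

definition ellipse :: "(real^2) set \<Rightarrow> bool" where
  "ellipse E \<longleftrightarrow> (\<exists>c a b. ellipse_with E c a b)"

definition center :: "(real^2) set \<Rightarrow> real^2" where
  "center E = (THE c. \<exists>a b. ellipse_with E c a b)"

definition eccentricity :: "(real^2) set \<Rightarrow> real" where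
  "eccentricity E = (THE e. \<exists>c a b. ellipse_with E c a b \<and> e = sqrt (1 - b\<^sup>2 / a\<^sup>2))"

text \<open>The two definite descriptions above are well defined: an ellipse determines its center and
  its semi-axes.\<close>

lemma orthonormal_sum_squares:
  fixes a b c d x y :: real
  assumes c: "a * a + b * b = 1" "c * c + d * d = 1" "a * c + b * d = 0"
  shows "(a * x + b * y)\<^sup>2 + (c * x + d * y)\<^sup>2 = x * x + y * y"
proof -
  define t where "t = a * d - b * c"
  have "(a * d - b * c)\<^sup>2 = 1" "d = (a * d - b * c) * a" "c = - ((a * d - b * c) * b)"
    using c by algebra+
  then have "d = t * a" "c = - (t * b)" "t\<^sup>2 = 1" by (simp_all add: t_def)
  then have "(a * x + b * y)\<^sup>2 + (c * x + d * y)\<^sup>2 = (a * a + b * b) * (x * x + y * y)"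
    by algebra
  then show ?thesis using c by simp
qed

lemma ellipse_with_nonempty_bounds:
  assumes "ellipse_with E c a b"
  obtains u v where "norm u = 1" "norm v = 1" "c + a *\<^sub>R u \<in> E" "c + b *\<^sub>R v \<in> E"
    "\<And>p. p \<in> E \<Longrightarrow> b \<le> dist p c \<and> dist p c \<le> a"
    "\<And>p. p \<in> E \<Longrightarrow> 2 *\<^sub>R c - p \<in> E"
proof -
  obtain u v where ab: "a \<ge> b" "b > 0" and uv: "norm u = 1" "norm v = 1" "u \<bullet> v = 0"
    and E: "E = {p. (u \<bullet> (p - c) / a)\<^sup>2 + (v \<bullet> (p - c) / b)\<^sup>2 = 1}"
    using assms unfolding ellipse_with_def by blast
  have uu: "u \<bullet> u = 1" "v \<bullet> v = 1" "v \<bullet> u = 0"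
    using uv by (simp_all add: norm_eq_1 inner_commute)
  have n2: "(u \<bullet> w)\<^sup>2 + (v \<bullet> w)\<^sup>2 = (norm w)\<^sup>2" for w
    using orthonormal_sum_squares[of "u$1" "u$2" "v$1" "v$2" "w$1" "w$2"] uu uv(3)
    by (simp add: inner_vec_def sum_2 power2_norm_eq_inner)
  have bnd: "b \<le> dist p c \<and> dist p c \<le> a" if "p \<in> E" for p
  proof -
    define x where "x = (u \<bullet> (p - c))\<^sup>2"
    define y where "y = (v \<bullet> (p - c))\<^sup>2"
    have x: "x \<ge> 0" "y \<ge> 0" "x / a\<^sup>2 + y / b\<^sup>2 = 1" "x + y = (dist p c)\<^sup>2"
      using that n2[of "p - c"] by (auto simp: E x_def y_def power_divide dist_norm)
    have ab2: "b\<^sup>2 \<le> a\<^sup>2" "0 < b\<^sup>2" "0 < a\<^sup>2"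
      using ab by (auto intro: power_mono)
    have "y / a\<^sup>2 \<le> y / b\<^sup>2" "x / a\<^sup>2 \<le> x / b\<^sup>2"
      using x(1,2) ab2 by (auto intro!: divide_left_mono mult_pos_pos)
    then have "x / a\<^sup>2 + y / a\<^sup>2 \<le> 1" "1 \<le> x / b\<^sup>2 + y / b\<^sup>2"
      using x(3) by linarith+
    then have "x + y \<le> a\<^sup>2" "b\<^sup>2 \<le> x + y"
      using ab2 by (simp_all add: add_divide_distrib[symmetric] divide_le_eq le_divide_eq)
    then show ?thesis
      using x ab by (auto intro: power2_le_imp_le)
  qed
  have "2 *\<^sub>R c - p \<in> E" if "p \<in> E" for p
  proof -
    have "2 *\<^sub>R c - p - c = - (p - c)" by (simp add: scaleR_2)
    then show ?thesis
      using that unfolding E mem_Collect_eq by (simp only: inner_minus_right minus_divide_left[symmetric] power2_minus)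
  qed
  moreover have "c + a *\<^sub>R u \<in> E" "c + b *\<^sub>R v \<in> E"
    using ab uu uv(3) by (simp_all add: E)
  ultimately show thesis using that uv(1,2) bnd by blast
qed

lemma ellipse_with_unique:
  assumes 1: "ellipse_with E c a b" and 2: "ellipse_with E c' a' b'"
  shows "c' = c" "a' = a" "b' = b"
proof -
  obtain u v where e: "norm u = 1" "norm v = 1" "c + a *\<^sub>R u \<in> E" "c + b *\<^sub>R v \<in> E"
    "\<And>p. p \<in> E \<Longrightarrow> b \<le> dist p c \<and> dist p c \<le> a" "\<And>p. p \<in> E \<Longrightarrow> 2 *\<^sub>R c - p \<in> E"
    using ellipse_with_nonempty_bounds[OF 1] by blast
  obtain u' v' where e': "norm u' = 1" "norm v' = 1" "c' + a' *\<^sub>R u' \<in> E" "c' + b' *\<^sub>R v' \<in> E"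
    "\<And>p. p \<in> E \<Longrightarrow> b' \<le> dist p c' \<and> dist p c' \<le> a'" "\<And>p. p \<in> E \<Longrightarrow> 2 *\<^sub>R c' - p \<in> E"
    using ellipse_with_nonempty_bounds[OF 2] by blast
  have ab: "0 < b" "b \<le> a" "0 < b'" "b' \<le> a'"
    using 1 2 by (auto simp: ellipse_with_def)
  have shift: "p + real n *\<^sub>R (2 *\<^sub>R (c' - c)) \<in> E" if "p \<in> E" for p n
  proof (induction n)
    case (Suc n)
    from e'(6)[OF e(6)[OF Suc]] show ?case
      by (simp add: algebra_simps scaleR_2)
  qed (use that in simp)
  show c: "c' = c"
  proof (rule ccontr)
    assume "c' \<noteq> c"
    define d where "d = 2 *\<^sub>R (c' - c)"
    have "norm d > 0" using \<open>c' \<noteq> c\<close> by (simp add: d_def)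
    then obtain n where n: "real n * norm d > 2 * a"
      using reals_Archimedean3 by blast
    have "dist (c + a *\<^sub>R u + real n *\<^sub>R d) c \<le> a"
      using shift[OF e(3)] e(5) unfolding d_def by blast
    then have "norm (a *\<^sub>R u + real n *\<^sub>R d) \<le> a"
      by (simp add: dist_norm algebra_simps)
    moreover have "real n * norm d \<le> norm (a *\<^sub>R u + real n *\<^sub>R d) + norm (a *\<^sub>R u)"
      using norm_triangle_ineq4[of "a *\<^sub>R u + real n *\<^sub>R d" "a *\<^sub>R u"] by simp
    ultimately show False using n e(1) ab by simp
  qed
  have d: "dist (x + y) x = norm y" for x y :: "real^2" by (simp add: dist_norm)
  show "a' = a"
    using e(5)[OF e'(3)] e'(5)[OF e(3)] ab by (simp add: c d e(1) e'(1))
  show "b' = b"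
    using e(5)[OF e'(4)] e'(5)[OF e(4)] ab by (simp add: c d e(2) e'(2))
qed

lemma center_eq: "ellipse_with E c a b \<Longrightarrow> center E = c"
  unfolding center_def using ellipse_with_unique(1) by blast

lemma eccentricity_eq: "ellipse_with E c a b \<Longrightarrow> eccentricity E = sqrt (1 - b\<^sup>2 / a\<^sup>2)"
  unfolding eccentricity_def using ellipse_with_unique(2,3) by blast

section \<open>Conjugate diameters\<close>

text \<open>Segments, chords and diameters are given by their two (distinct) endpoints.\<close>

definition parallel :: "real^2 \<Rightarrow> real^2 \<Rightarrow> real^2 \<Rightarrow> real^2 \<Rightarrow> bool" where
  "parallel p q r s \<longleftrightarrow> p \<noteq> q \<and> r \<noteq> s \<and> (\<exists>k. q - p = k *\<^sub>R (s - r))"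

definition chord :: "(real^2) set \<Rightarrow> real^2 \<Rightarrow> real^2 \<Rightarrow> bool" where
  "chord E p q \<longleftrightarrow> p \<in> E \<and> q \<in> E \<and> p \<noteq> q"

definition ellipse_diameter :: "(real^2) set \<Rightarrow> real^2 \<Rightarrow> real^2 \<Rightarrow> bool" where
  "ellipse_diameter E p q \<longleftrightarrow> chord E p q \<and> center E \<in> closed_segment p q"

definition conjugate_diameters ::
    "(real^2) set \<Rightarrow> real^2 \<Rightarrow> real^2 \<Rightarrow> real^2 \<Rightarrow> real^2 \<Rightarrow> bool" where
  "conjugate_diameters E p q r s \<longleftrightarrow>
     ellipse_diameter E p q \<and> ellipse_diameter E r s \<and>
     (\<forall>x y. chord E x y \<and> parallel x y r s \<longrightarrow> midpoint x y \<in> closed_segment p q) \<and>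
     (\<forall>x y. chord E x y \<and> parallel x y p q \<longrightarrow> midpoint x y \<in> closed_segment r s)"

text \<open>The case distinction is needed because \<open>tan\<close> is total, with value 0 where the
  cosine vanishes.\<close>

definition directional_constant :: "real \<Rightarrow> ereal" where
  "directional_constant \<theta> = (if cos \<theta> = 0 then \<infinity> else ereal (tan \<theta>))"

definition has_direction :: "real^2 \<Rightarrow> real^2 \<Rightarrow> ereal \<Rightarrow> bool" where
  "has_direction p q M \<longleftrightarrow> p \<noteq> q \<and>
     (\<exists>\<theta>. q - p = dist p q *\<^sub>R vector [cos \<theta>, sin \<theta>] \<and> M = directional_constant \<theta>)"

definition conjugate_directions :: "(real^2) set \<Rightarrow> ereal \<Rightarrow> ereal \<Rightarrow> bool" where
  "conjugate_directions E M\<^sub>1 M\<^sub>2 \<longleftrightarrow>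
     (\<exists>p q r s. conjugate_diameters E p q r s \<and> has_direction p q M\<^sub>1 \<and> has_direction r s M\<^sub>2)"

definition equal_conjugate_directions :: "(real^2) set \<Rightarrow> ereal \<Rightarrow> ereal \<Rightarrow> bool" where
  "equal_conjugate_directions E M\<^sub>1 M\<^sub>2 \<longleftrightarrow>
     (\<exists>p q r s. conjugate_diameters E p q r s \<and> dist p q = dist r s \<and>
        has_direction p q M\<^sub>1 \<and> has_direction r s M\<^sub>2)"

section \<open>Quadrilaterals\<close>

definition vertices :: "(real^2) set \<Rightarrow> (real^2) set" where
  "vertices R = {x. x extreme_point_of R}"

definition convex_quadrilateral :: "(real^2) set \<Rightarrow> bool" where
  "convex_quadrilateral R \<longleftrightarrow> polytope R \<and> card (vertices R) = 4"

definition trapezoid :: "(real^2) set \<Rightarrow> bool" where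
  "trapezoid R \<longleftrightarrow> convex_quadrilateral R \<and>
     (\<exists>p q r s. closed_segment p q edge_of R \<and> closed_segment r s edge_of R \<and>
        closed_segment p q \<noteq> closed_segment r s \<and> parallel p q r s)"

definition circumscribed_ellipse :: "(real^2) set \<Rightarrow> (real^2) set \<Rightarrow> bool" where
  "circumscribed_ellipse R E \<longleftrightarrow> ellipse E \<and> vertices R \<subseteq> E"

end

theory Submission
  imports Defs
begin

text \<open>Let the diagonals of the quadrilateral meet in \<open>z\<close>. Along each diagonal the unit of length can be
  chosen so that the distances from \<open>z\<close> to its two endpoints are reciprocal to each other; the
  vertices are then \<open>z + s *\<^sub>R e\<close>, \<open>z - (1 / s) *\<^sub>R e\<close>, \<open>z + t *\<^sub>R f\<close> and \<open>z - (1 / t) *\<^sub>R f\<close>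
  (\<open>quadrilateral_normal_form\<close>). A conic that passes through these four points has, in the
  coordinates \<open>x, y\<close> with respect to \<open>e, f\<close>, equal coefficients at \<open>x\<^sup>2\<close> and \<open>y\<^sup>2\<close>, because both
  restrictions to an axis have the same constant term and two roots with product \<open>-1\<close>. So the
  circumscribed ellipses are exactly the conics with quadratic part \<open>x\<^sup>2 + 2 k x y + y\<^sup>2\<close> and \<open>\<bar>k\<bar> < 1\<close>, the remaining coefficients being the same for
  all of them (\<open>ellipse_through_vertices\<close>, \<open>vertex_conic_as_affine_circle\<close>).

  The substitution \<open>x = X + Y\<close>, \<open>y = X - Y\<close> turns the quadratic part into
  \<open>2 (1 + k) X\<^sup>2 + 2 (1 - k) Y\<^sup>2\<close>. Hence \<open>e + f\<close> and \<open>e - f\<close> are conjugate for every \<open>k\<close>, and they are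
  the only pair with this property, since two values of \<open>k\<close> already determine it
  (\<open>common_conjugate_directions\<close>). Thus \<open>M\<^sub>1\<close> and \<open>M\<^sub>2\<close> are the directions of \<open>e + f\<close> and \<open>e - f\<close>, and
  the ellipse with parameter \<open>k\<close> has conjugate semidiameters \<open>g = \<alpha> *\<^sub>R (e + f)\<close> and
  \<open>h = \<beta> *\<^sub>R (e - f)\<close> with \<open>(1 + k) \<alpha>\<^sup>2 = (1 - k) \<beta>\<^sup>2\<close>.

  By the relations of Apollonius (\<open>apollonius\<close>), the semi-axes satisfy \<open>a\<^sup>2 + b\<^sup>2 = \<bar>g\<bar>\<^sup>2 + \<bar>h\<bar>\<^sup>2\<close> and
  \<open>a b = \<bar>area g h\<bar>\<close>, so the eccentricity is an increasing function of
  \<open>a / b + b / a = (\<bar>g\<bar>\<^sup>2 + \<bar>h\<bar>\<^sup>2) / \<bar>area g h\<bar>\<close>. As the directions of \<open>g\<close> and \<open>h\<close> do not depend on \<open>k\<close>,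
  the denominator is a constant times \<open>\<bar>g\<bar> \<bar>h\<bar>\<close>, and the quotient is least precisely when
  \<open>\<bar>g\<bar> = \<bar>h\<bar>\<close> (\<open>eccentricity_less_if_equal\<close>). This is at the same time the condition that the
  conjugate diameters with directions \<open>M\<^sub>1\<close> and \<open>M\<^sub>2\<close> are equal, and exactly one \<open>k\<close> satisfies it.\<close>

section \<open>Affine images of the unit circle\<close>

definition area :: "real^2 \<Rightarrow> real^2 \<Rightarrow> real" where
  "area u v = u $ 1 * v $ 2 - u $ 2 * v $ 1"

text \<open>For linearly independent \<open>g\<close> and \<open>h\<close>, the ellipse with center \<open>c\<close> and conjugate semidiameters \<open>g\<close>
  and \<open>h\<close>. Conjugacy with respect to such
  an ellipse is perpendicularity in the coordinates given by \<open>g\<close> and \<open>h\<close>.\<close>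

definition affine_circle :: "real^2 \<Rightarrow> real^2 \<Rightarrow> real^2 \<Rightarrow> (real^2) set" where
  "affine_circle c g h = {c + x *\<^sub>R g + y *\<^sub>R h | x y. x\<^sup>2 + y\<^sup>2 = 1}"

lemma area_scaled: "area (x *\<^sub>R g) (y *\<^sub>R h) = x * y * area g h"
  by (simp add: area_def algebra_simps)

lemma area_sum_diff: "area (e + f) (e - f) = - 2 * area e f"
  by (simp add: area_def algebra_simps)

lemma inner_real2: "u \<bullet> v = u $ 1 * v $ 1 + u $ 2 * v $ 2" for u v :: "real^2"
  by (simp add: inner_vec_def sum_2)

text \<open>Lagrange's identity.\<close>

lemma area_squared: "(area g h)\<^sup>2 = (g \<bullet> g) * (h \<bullet> h) - (g \<bullet> h)\<^sup>2"
  by (simp add: inner_real2 area_def power2_eq_square algebra_simps)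

lemma combination_exists:
  assumes "area g h \<noteq> 0"
  obtains x y where "w = x *\<^sub>R g + y *\<^sub>R h"
proof
  show "w = (area w h / area g h) *\<^sub>R g + (area g w / area g h) *\<^sub>R h"
    using assms by (simp add: vec_eq_iff forall_2 field_simps) (simp add: area_def algebra_simps)
qed

lemma point_coordinates:
  assumes "area g h \<noteq> 0"
  obtains x y where "p = c + (x *\<^sub>R g + y *\<^sub>R h)"
  using combination_exists[OF assms, of "p - c"] by (metis add.commute diff_add_cancel)

lemma combination_unique:
  assumes "area g h \<noteq> 0"
  shows "x *\<^sub>R g + y *\<^sub>R h = x' *\<^sub>R g + y' *\<^sub>R h \<longleftrightarrow> x = x' \<and> y = y'"
proof
  assume eq: "x *\<^sub>R g + y *\<^sub>R h = x' *\<^sub>R g + y' *\<^sub>R h"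
  have "x * area g h = area (x *\<^sub>R g + y *\<^sub>R h) h" "y * area g h = area g (x *\<^sub>R g + y *\<^sub>R h)"
    "x' * area g h = area (x' *\<^sub>R g + y' *\<^sub>R h) h" "y' * area g h = area g (x' *\<^sub>R g + y' *\<^sub>R h)"
    by (simp_all add: area_def algebra_simps)
  with eq assms show "x = x' \<and> y = y'" by (metis mult_cancel_right)
qed auto

lemma mem_affine_circle:
  assumes "area g h \<noteq> 0"
  shows "c + (x *\<^sub>R g + y *\<^sub>R h) \<in> affine_circle c g h \<longleftrightarrow> x\<^sup>2 + y\<^sup>2 = 1"
  using combination_unique[OF assms] by (auto simp: affine_circle_def add.assoc)

lemma affine_circle_commute: "affine_circle c h g = affine_circle c g h"
proof -
  have "affine_circle c h g \<subseteq> affine_circle c g h" for g h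
  proof
    fix p assume "p \<in> affine_circle c h g"
    then obtain x y where "x\<^sup>2 + y\<^sup>2 = 1" "p = c + x *\<^sub>R h + y *\<^sub>R g"
      by (auto simp: affine_circle_def)
    then have "y\<^sup>2 + x\<^sup>2 = 1" "p = c + y *\<^sub>R g + x *\<^sub>R h" by simp_all
    then show "p \<in> affine_circle c g h" unfolding affine_circle_def by blast
  qed
  then show ?thesis by blast
qed

text \<open>Rotating the unit circle replaces one pair of conjugate semidiameters by another pair of the same
  ellipse.\<close>

lemma affine_circle_rotate_subset:
  assumes "C\<^sup>2 + S\<^sup>2 = 1"
  shows "affine_circle c (C *\<^sub>R g + S *\<^sub>R h) (C *\<^sub>R h - S *\<^sub>R g) \<subseteq> affine_circle c g h"
proof
  fix p assume "p \<in> affine_circle c (C *\<^sub>R g + S *\<^sub>R h) (C *\<^sub>R h - S *\<^sub>R g)"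
  then obtain x y where xy: "x\<^sup>2 + y\<^sup>2 = 1"
    and p: "p = c + x *\<^sub>R (C *\<^sub>R g + S *\<^sub>R h) + y *\<^sub>R (C *\<^sub>R h - S *\<^sub>R g)"
    by (auto simp: affine_circle_def)
  have "p = c + (x * C - y * S) *\<^sub>R g + (x * S + y * C) *\<^sub>R h"
    by (simp add: p algebra_simps)
  moreover have "(x * C - y * S)\<^sup>2 + (x * S + y * C)\<^sup>2 = (x\<^sup>2 + y\<^sup>2) * (C\<^sup>2 + S\<^sup>2)"
    by algebra
  ultimately show "p \<in> affine_circle c g h"
    using xy assms by (auto simp: affine_circle_def)
qed

text \<open>The reverse inclusion is the preceding lemma for the inverse rotation.\<close>

lemma affine_circle_rotate:
  assumes "C\<^sup>2 + S\<^sup>2 = 1"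
  shows "affine_circle c (C *\<^sub>R g + S *\<^sub>R h) (C *\<^sub>R h - S *\<^sub>R g) = affine_circle c g h"
proof
  let ?g = "C *\<^sub>R g + S *\<^sub>R h" and ?h = "C *\<^sub>R h - S *\<^sub>R g"
  have "C *\<^sub>R ?g + (- S) *\<^sub>R ?h = (C\<^sup>2 + S\<^sup>2) *\<^sub>R g" "C *\<^sub>R ?h - (- S) *\<^sub>R ?g = (C\<^sup>2 + S\<^sup>2) *\<^sub>R h"
    by (simp_all add: algebra_simps power2_eq_square)
  then show "affine_circle c g h \<subseteq> affine_circle c ?g ?h"
    using affine_circle_rotate_subset[of C "- S" c ?g ?h] assms by simp
qed (rule affine_circle_rotate_subset[OF assms])

section \<open>The relations of Apollonius and the eccentricity\<close>

text \<open>Principal axes: after a rotation by \<open>\<phi> / 2\<close> the inner product of the two semidiameters is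
  \<open>cos \<phi> * (g \<bullet> h) - sin \<phi> * (g \<bullet> g - h \<bullet> h) / 2\<close>, which vanishes for a suitable \<open>\<phi>\<close>.\<close>

lemma orthogonal_rotation_exists:
  fixes g h :: "real^2"
  obtains C S where "C\<^sup>2 + S\<^sup>2 = 1" "(C *\<^sub>R g + S *\<^sub>R h) \<bullet> (C *\<^sub>R h - S *\<^sub>R g) = 0"
proof -
  obtain r \<phi> where r: "g \<bullet> g - h \<bullet> h = r * cos \<phi>" "2 * (g \<bullet> h) = r * sin \<phi>"
    using polar_Ex by blast
  define C S where "C = cos (\<phi> / 2)" and "S = sin (\<phi> / 2)"
  have CS: "cos \<phi> = C\<^sup>2 - S\<^sup>2" "sin \<phi> = 2 * S * C"
    using cos_double[of "\<phi> / 2"] sin_double[of "\<phi> / 2"] by (simp_all add: C_def S_def)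
  have "(C *\<^sub>R g + S *\<^sub>R h) \<bullet> (C *\<^sub>R h - S *\<^sub>R g)
      = (C\<^sup>2 - S\<^sup>2) * (g \<bullet> h) - S * C * (g \<bullet> g - h \<bullet> h)"
    by (simp add: inner_real2 power2_eq_square algebra_simps)
  also have "\<dots> = 0"
  proof -
    have "2 * (g \<bullet> h) = r * (2 * S * C)" "g \<bullet> g - h \<bullet> h = r * (C\<^sup>2 - S\<^sup>2)"
      using r CS by simp_all
    then show ?thesis by algebra
  qed
  finally show thesis using that[of C S] by (simp add: C_def S_def)
qed

lemma ellipse_with_orthogonal_axes:
  assumes gh: "g \<bullet> h = 0" and h: "h \<noteq> 0" and le: "norm h \<le> norm g"
  shows "ellipse_with (affine_circle c g h) c (norm g) (norm h)"
proof -
  have g: "g \<noteq> 0" using h le by auto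
  have "(area g h)\<^sup>2 \<noteq> 0" using gh g h by (simp add: area_squared)
  then have area: "area g h \<noteq> 0" by simp
  define u v where "u = g /\<^sub>R norm g" and "v = h /\<^sub>R norm h"
  have uv: "norm u = 1" "norm v = 1" "u \<bullet> v = 0" "u \<bullet> g = norm g" "u \<bullet> h = 0" "v \<bullet> g = 0" "v \<bullet> h = norm h"
    using g h gh by (simp_all add: u_def v_def inner_commute dot_square_norm power2_eq_square)
  have "p \<in> affine_circle c g h \<longleftrightarrow>
      (u \<bullet> (p - c) / norm g)\<^sup>2 + (v \<bullet> (p - c) / norm h)\<^sup>2 = 1" for p
  proof -
    obtain x y where p: "p = c + (x *\<^sub>R g + y *\<^sub>R h)" using point_coordinates[OF area] .
    have "u \<bullet> (p - c) / norm g = x" "v \<bullet> (p - c) / norm h = y"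
      unfolding p using g h by (simp_all add: inner_add_right uv)
    then show ?thesis using mem_affine_circle[OF area] p by metis
  qed
  then have "affine_circle c g h = {p. (u \<bullet> (p - c) / norm g)\<^sup>2 + (v \<bullet> (p - c) / norm h)\<^sup>2 = 1}"
    by blast
  then show ?thesis unfolding ellipse_with_def using h le uv(1-3) by auto
qed

text \<open>Rotating a pair of conjugate semidiameters preserves the sum of their squares and the area that
  they span; at the principal axes these are \<open>a\<^sup>2 + b\<^sup>2\<close> and \<open>a * b\<close>.\<close>

lemma apollonius:
  assumes "area g h \<noteq> 0"
  obtains a b where "ellipse_with (affine_circle c g h) c a b"
    "a\<^sup>2 + b\<^sup>2 = g \<bullet> g + h \<bullet> h" "a * b = \<bar>area g h\<bar>"
proof -
  obtain C S where CS: "C\<^sup>2 + S\<^sup>2 = 1" and o: "(C *\<^sub>R g + S *\<^sub>R h) \<bullet> (C *\<^sub>R h - S *\<^sub>R g) = 0"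
    using orthogonal_rotation_exists .
  define g' h' where "g' = C *\<^sub>R g + S *\<^sub>R h" and "h' = C *\<^sub>R h - S *\<^sub>R g"
  have E: "affine_circle c g' h' = affine_circle c g h"
    using affine_circle_rotate[OF CS] by (simp add: g'_def h'_def)
  have orth: "g' \<bullet> h' = 0" using o by (simp add: g'_def h'_def)
  have "area g' h' = (C\<^sup>2 + S\<^sup>2) * area g h"
    by (simp add: area_def g'_def h'_def power2_eq_square algebra_simps)
  then have area: "area g' h' = area g h" using CS by simp
  have "g' \<bullet> g' + h' \<bullet> h' = (C\<^sup>2 + S\<^sup>2) * (g \<bullet> g + h \<bullet> h)"
    by (simp add: inner_real2 g'_def h'_def power2_eq_square algebra_simps)
  then have sum: "(norm g')\<^sup>2 + (norm h')\<^sup>2 = g \<bullet> g + h \<bullet> h" using CS by (simp add: dot_square_norm)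
  have "(norm g' * norm h')\<^sup>2 = (area g h)\<^sup>2"
    using area_squared[of g' h'] orth area by (simp add: power_mult_distrib dot_square_norm)
  then have prod: "norm g' * norm h' = \<bar>area g h\<bar>"
    using power2_eq_iff_nonneg[of "norm g' * norm h'" "\<bar>area g h\<bar>"] by simp
  then have ne: "g' \<noteq> 0" "h' \<noteq> 0" using assms by auto
  show thesis
  proof (cases "norm h' \<le> norm g'")
    case True
    from that[OF ellipse_with_orthogonal_axes[OF orth ne(2) this, of c, unfolded E] sum prod]
    show thesis .
  next
    case False
    then have "ellipse_with (affine_circle c h' g') c (norm h') (norm g')"
      using ellipse_with_orthogonal_axes[of h' g' c] orth ne by (simp add: inner_commute)
    then show thesis using that[of "norm h'" "norm g'"] sum prod
      by (simp add: affine_circle_commute[of c h'] E algebra_simps)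
  qed
qed

lemma ellipse_affine_circle: "area g h \<noteq> 0 \<Longrightarrow> ellipse (affine_circle c g h)"
  unfolding ellipse_def by (metis apollonius)

lemma center_affine_circle: "area g h \<noteq> 0 \<Longrightarrow> center (affine_circle c g h) = c"
  by (metis apollonius center_eq)

text \<open>With \<open>\<rho> = b / a\<close> the quantity \<open>\<rho> + 1 / \<rho>\<close> is \<open>(a\<^sup>2 + b\<^sup>2) / (a * b)\<close>. It decreases strictly on
  the interval from 0 to 1, and so does the eccentricity as a function of \<open>\<rho>\<close>.\<close>

lemma axis_ratio_less_iff:
  fixes \<rho> \<rho>' :: real
  assumes "0 < \<rho>" "\<rho> \<le> 1" "0 < \<rho>'" "\<rho>' \<le> 1"
  shows "\<rho> + 1 / \<rho> < \<rho>' + 1 / \<rho>' \<longleftrightarrow> \<rho>' < \<rho>"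
proof -
  have mono: "y + 1 / y < x + 1 / x" if "x < y" "0 < x" "y \<le> 1" for x y :: real
  proof -
    have "x * y < 1" using mult_left_le[of y x] that by linarith
    then have "x + 1 / x - (y + 1 / y) = (y - x) * (1 - x * y) / (x * y)"
      using that by (simp add: field_simps)
    also have "\<dots> > 0" using that \<open>x * y < 1\<close> by (intro divide_pos_pos mult_pos_pos) auto
    finally show ?thesis by simp
  qed
  show ?thesis using mono[of \<rho>' \<rho>] mono[of \<rho> \<rho>'] assms
    by (cases \<rho> \<rho>' rule: linorder_cases) auto
qed

lemma eccentricity_less_iff:
  assumes "area g h \<noteq> 0" "area g' h' \<noteq> 0"
  shows "eccentricity (affine_circle c g h) < eccentricity (affine_circle c' g' h') \<longleftrightarrow>
    (g \<bullet> g + h \<bullet> h) / \<bar>area g h\<bar> < (g' \<bullet> g' + h' \<bullet> h') / \<bar>area g' h'\<bar>"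
proof -
  obtain a b where 1: "ellipse_with (affine_circle c g h) c a b"
    "a\<^sup>2 + b\<^sup>2 = g \<bullet> g + h \<bullet> h" "a * b = \<bar>area g h\<bar>" using apollonius[OF assms(1)] .
  obtain a' b' where 2: "ellipse_with (affine_circle c' g' h') c' a' b'"
    "a'\<^sup>2 + b'\<^sup>2 = g' \<bullet> g' + h' \<bullet> h'" "a' * b' = \<bar>area g' h'\<bar>" using apollonius[OF assms(2)] .
  have ab: "0 < b" "b \<le> a" "0 < b'" "b' \<le> a'"
    using 1(1) 2(1) by (auto simp: ellipse_with_def)
  have ratio: "(x\<^sup>2 + y\<^sup>2) / (x * y) = y / x + 1 / (y / x)" if "0 < y" "y \<le> x" for x y :: real
    using that by (simp add: field_simps power2_eq_square)
  have "(a\<^sup>2 + b\<^sup>2) / (a * b) < (a'\<^sup>2 + b'\<^sup>2) / (a' * b') \<longleftrightarrow> b' / a' < b / a"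
    unfolding ratio[OF ab(1,2)] ratio[OF ab(3,4)]
    by (rule axis_ratio_less_iff) (use ab in auto)
  also have "\<dots> \<longleftrightarrow> (b' / a')\<^sup>2 < (b / a)\<^sup>2"
    using ab by (intro iffI power_strict_mono) (auto dest: power_less_imp_less_base)
  also have "\<dots> \<longleftrightarrow> sqrt (1 - b\<^sup>2 / a\<^sup>2) < sqrt (1 - b'\<^sup>2 / a'\<^sup>2)"
    by (simp add: power_divide)
  finally show ?thesis using 1 2 by (simp add: eccentricity_eq)
qed

text \<open>For fixed directions of the conjugate semidiameters, the area that they span is proportional to
  the product of their lengths \<open>p\<close> and \<open>q\<close>. So the quantity that governs the eccentricity is a constant
  times \<open>(p\<^sup>2 + q\<^sup>2) / (p * q) = 2 + (p - q)\<^sup>2 / (p * q)\<close>.\<close>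

lemma eccentricity_less_if_equal:
  assumes area: "area G H \<noteq> 0" and pos: "\<alpha> > 0" "\<beta> > 0" "\<alpha>' > 0" "\<beta>' > 0"
    and eq: "norm (\<alpha>' *\<^sub>R G) = norm (\<beta>' *\<^sub>R H)" and ne: "norm (\<alpha> *\<^sub>R G) \<noteq> norm (\<beta> *\<^sub>R H)"
  shows "eccentricity (affine_circle c' (\<alpha>' *\<^sub>R G) (\<beta>' *\<^sub>R H))
    < eccentricity (affine_circle c (\<alpha> *\<^sub>R G) (\<beta> *\<^sub>R H))"
proof -
  have GH: "norm G > 0" "norm H > 0" using area by (auto simp: area_def)
  define L where "L = norm G * norm H / \<bar>area G H\<bar>"
  have L: "L > 0" using GH area by (simp add: L_def)
  have ratio: "((x *\<^sub>R G) \<bullet> (x *\<^sub>R G) + (y *\<^sub>R H) \<bullet> (y *\<^sub>R H)) / \<bar>area (x *\<^sub>R G) (y *\<^sub>R H)\<bar>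
      = L * (2 + (norm (x *\<^sub>R G) - norm (y *\<^sub>R H))\<^sup>2 / (norm (x *\<^sub>R G) * norm (y *\<^sub>R H)))"
    if "x > 0" "y > 0" for x y
  proof -
    have "L * (2 + (norm (x *\<^sub>R G) - norm (y *\<^sub>R H))\<^sup>2 / (norm (x *\<^sub>R G) * norm (y *\<^sub>R H)))
        = L * ((norm (x *\<^sub>R G))\<^sup>2 + (norm (y *\<^sub>R H))\<^sup>2) / (norm (x *\<^sub>R G) * norm (y *\<^sub>R H))"
      using GH that by (simp add: field_simps power2_eq_square)
    also have "\<dots> = ((norm (x *\<^sub>R G))\<^sup>2 + (norm (y *\<^sub>R H))\<^sup>2) / \<bar>area (x *\<^sub>R G) (y *\<^sub>R H)\<bar>"
      using GH that by (simp add: L_def area_scaled abs_mult)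
    finally show ?thesis by (simp only: power2_norm_eq_inner)
  qed
  have "(norm (\<alpha> *\<^sub>R G) - norm (\<beta> *\<^sub>R H))\<^sup>2 / (norm (\<alpha> *\<^sub>R G) * norm (\<beta> *\<^sub>R H)) > 0"
    using ne GH pos by simp
  then have "L * (2 + (norm (\<alpha>' *\<^sub>R G) - norm (\<beta>' *\<^sub>R H))\<^sup>2 / (norm (\<alpha>' *\<^sub>R G) * norm (\<beta>' *\<^sub>R H)))
      < L * (2 + (norm (\<alpha> *\<^sub>R G) - norm (\<beta> *\<^sub>R H))\<^sup>2 / (norm (\<alpha> *\<^sub>R G) * norm (\<beta> *\<^sub>R H)))"
    using eq L by simp
  then show ?thesis
    unfolding ratio[OF pos(1,2), symmetric] ratio[OF pos(3,4), symmetric]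
    using area pos by (simp add: eccentricity_less_iff area_scaled)
qed

section \<open>Conjugate diameters\<close>

lemma mem_centered_segment:
  fixes c w :: "real^2"
  assumes "x \<in> closed_segment (c - w) (c + w)"
  obtains \<kappa> where "x = c + \<kappa> *\<^sub>R w" "\<bar>\<kappa>\<bar> \<le> 1"
proof -
  obtain u where u: "0 \<le> u" "u \<le> 1" "x = (1 - u) *\<^sub>R (c - w) + u *\<^sub>R (c + w)"
    using assms by (auto simp: in_segment)
  then have "x = c + (2 * u - 1) *\<^sub>R w"
    by (simp add: vec_eq_iff algebra_simps)
  then show thesis using that[of "2 * u - 1"] u by simp
qed

lemma centered_segmentI:
  fixes c w :: "real^2"
  assumes "\<bar>\<kappa>\<bar> \<le> 1"
  shows "c + \<kappa> *\<^sub>R w \<in> closed_segment (c - w) (c + w)"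
proof -
  have "c + \<kappa> *\<^sub>R w = (1 - (1 + \<kappa>) / 2) *\<^sub>R (c - w) + ((1 + \<kappa>) / 2) *\<^sub>R (c + w)"
    by (simp add: vec_eq_iff field_simps)
  then show ?thesis using assms unfolding in_segment by (intro exI[of _ "(1 + \<kappa>) / 2"]) auto
qed

lemma diameter_affine_circle:
  assumes area: "area g h \<noteq> 0" and d: "ellipse_diameter (affine_circle c g h) p q"
  obtains x y where "x\<^sup>2 + y\<^sup>2 = 1" "p = c - (x *\<^sub>R g + y *\<^sub>R h)" "q = c + (x *\<^sub>R g + y *\<^sub>R h)"
proof -
  have pq: "p \<in> affine_circle c g h" "q \<in> affine_circle c g h" "p \<noteq> q" "c \<in> closed_segment p q"
    using d by (auto simp: ellipse_diameter_def chord_def center_affine_circle[OF area])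
  obtain x y where xy: "x\<^sup>2 + y\<^sup>2 = 1" and q: "q = c + (x *\<^sub>R g + y *\<^sub>R h)"
    using pq(2) by (auto simp: affine_circle_def add.assoc)
  obtain x' y' where xy': "x'\<^sup>2 + y'\<^sup>2 = 1" and p: "p = c + (x' *\<^sub>R g + y' *\<^sub>R h)"
    using pq(1) by (auto simp: affine_circle_def add.assoc)
  obtain u where u: "0 \<le> u" "u \<le> 1" "c = (1 - u) *\<^sub>R p + u *\<^sub>R q"
    using pq(4) by (auto simp: in_segment)
  have "((1 - u) * x' + u * x) *\<^sub>R g + ((1 - u) * y' + u * y) *\<^sub>R h = 0 *\<^sub>R g + 0 *\<^sub>R h"
    using u(3) unfolding p q by (simp add: algebra_simps)
  then have eq: "(1 - u) * x' = - (u * x)" "(1 - u) * y' = - (u * y)"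
    unfolding combination_unique[OF area] by auto
  have "(1 - u)\<^sup>2 * (x'\<^sup>2 + y'\<^sup>2) = u\<^sup>2 * (x\<^sup>2 + y\<^sup>2)"
    using eq by algebra
  then have "(1 - u)\<^sup>2 = u\<^sup>2" using xy xy' by simp
  then have u: "u = 1 / 2" by (simp add: power2_eq_square algebra_simps)
  then have "x' = - x" "y' = - y" using eq unfolding u by simp_all
  then show thesis using that[of x y] xy p q by simp
qed

text \<open>In the coordinates given by \<open>g\<close> and \<open>h\<close>, let \<open>w\<close> and \<open>w'\<close> be the unit vectors along the two diameters.
  It suffices to test a single chord parallel to \<open>w'\<close>, off the center: its midpoint is a nonzero
  multiple of the perpendicular of \<open>w'\<close> and lies on the line of \<open>w\<close>.\<close>

lemma conjugate_semidiameters_perpendicular: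
  assumes area: "area g h \<noteq> 0" and conj: "conjugate_diameters (affine_circle c g h) p q r s"
  obtains x y x' y' where "x\<^sup>2 + y\<^sup>2 = 1" "q - p = 2 *\<^sub>R (x *\<^sub>R g + y *\<^sub>R h)"
    "x'\<^sup>2 + y'\<^sup>2 = 1" "s - r = 2 *\<^sub>R (x' *\<^sub>R g + y' *\<^sub>R h)" "x * x' + y * y' = 0"
proof -
  let ?E = "affine_circle c g h"
  have d: "ellipse_diameter ?E p q" "ellipse_diameter ?E r s"
    and mid: "\<And>a b. chord ?E a b \<Longrightarrow> parallel a b r s \<Longrightarrow> midpoint a b \<in> closed_segment p q"
    using conj by (auto simp: conjugate_diameters_def)
  obtain x y where xy: "x\<^sup>2 + y\<^sup>2 = 1" and p: "p = c - (x *\<^sub>R g + y *\<^sub>R h)"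
    and q: "q = c + (x *\<^sub>R g + y *\<^sub>R h)" using diameter_affine_circle[OF area d(1)] .
  obtain x' y' where xy': "x'\<^sup>2 + y'\<^sup>2 = 1" and r: "r = c - (x' *\<^sub>R g + y' *\<^sub>R h)"
    and s: "s = c + (x' *\<^sub>R g + y' *\<^sub>R h)" using diameter_affine_circle[OF area d(2)] .
  \<comment> \<open>The chord joins the points of the unit circle at 45 degrees on either side of the
      perpendicular of \<open>(x', y')\<close>.\<close>
  define \<mu> :: real where "\<mu> = 1 / sqrt 2"
  have \<mu>: "\<mu>\<^sup>2 = 1 / 2" "\<mu> \<noteq> 0" by (simp_all add: \<mu>_def power_divide)
  define a where "a = c + ((\<mu> * (- y' - x')) *\<^sub>R g + (\<mu> * (x' - y')) *\<^sub>R h)"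
  define b where "b = c + ((\<mu> * (- y' + x')) *\<^sub>R g + (\<mu> * (x' + y')) *\<^sub>R h)"
  have "(\<mu> * (- y' - x'))\<^sup>2 + (\<mu> * (x' - y'))\<^sup>2 = 1" "(\<mu> * (- y' + x'))\<^sup>2 + (\<mu> * (x' + y'))\<^sup>2 = 1"
    using \<mu>(1) xy' by algebra+
  then have ab: "a \<in> ?E" "b \<in> ?E" unfolding a_def b_def mem_affine_circle[OF area] .
  have ba: "b - a = \<mu> *\<^sub>R (s - r)" unfolding a_def b_def r s
    by (simp add: vec_eq_iff algebra_simps)
  have "s \<noteq> r" using d(2) by (auto simp: ellipse_diameter_def chord_def)
  then have "a \<noteq> b" using ba \<mu>(2) by auto
  then have "midpoint a b \<in> closed_segment p q"
    using mid[of a b] ab ba \<open>s \<noteq> r\<close> unfolding chord_def parallel_def by blast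
  moreover have "midpoint a b = c + ((- (\<mu> * y')) *\<^sub>R g + (\<mu> * x') *\<^sub>R h)"
    by (simp add: midpoint_def a_def b_def vec_eq_iff field_simps)
  ultimately obtain \<kappa> where
    "c + ((- (\<mu> * y')) *\<^sub>R g + (\<mu> * x') *\<^sub>R h) = c + \<kappa> *\<^sub>R (x *\<^sub>R g + y *\<^sub>R h)"
    unfolding p q by (metis mem_centered_segment)
  then have "(- (\<mu> * y')) *\<^sub>R g + (\<mu> * x') *\<^sub>R h = (\<kappa> * x) *\<^sub>R g + (\<kappa> * y) *\<^sub>R h"
    by (simp add: algebra_simps)
  then have "- (\<mu> * y') = \<kappa> * x" "\<mu> * x' = \<kappa> * y"
    unfolding combination_unique[OF area] by auto
  then have "\<mu> * (x * x' + y * y') = 0" by algebra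
  then have "x * x' + y * y' = 0" using \<mu>(2) by simp
  moreover have "q - p = 2 *\<^sub>R (x *\<^sub>R g + y *\<^sub>R h)" "s - r = 2 *\<^sub>R (x' *\<^sub>R g + y' *\<^sub>R h)"
    unfolding p q r s by (simp_all add: scaleR_2)
  ultimately show thesis using that xy xy' by blast
qed

text \<open>In coordinates: a chord of the unit circle parallel to the second axis joins \<open>(x, y)\<close> and \<open>(x, - y)\<close>.\<close>

lemma parallel_chord_bisected:
  assumes area: "area g h \<noteq> 0" and xy: "chord (affine_circle c g h) a b"
    and par: "parallel a b (c - h) (c + h)"
  shows "midpoint a b \<in> closed_segment (c - g) (c + g)"
proof -
  obtain x y where x: "x\<^sup>2 + y\<^sup>2 = 1" and a: "a = c + (x *\<^sub>R g + y *\<^sub>R h)"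
    using xy by (auto simp: affine_circle_def add.assoc chord_def)
  obtain x' y' where x': "x'\<^sup>2 + y'\<^sup>2 = 1" and b: "b = c + (x' *\<^sub>R g + y' *\<^sub>R h)"
    using xy by (auto simp: affine_circle_def add.assoc chord_def)
  obtain \<kappa> where "b - a = \<kappa> *\<^sub>R ((c + h) - (c - h))" and "a \<noteq> b"
    using par unfolding parallel_def by blast
  then have "(x' - x) *\<^sub>R g + (y' - y) *\<^sub>R h = 0 *\<^sub>R g + (2 * \<kappa>) *\<^sub>R h"
    unfolding a b by (simp add: vec_eq_iff algebra_simps)
  then have "x' = x" unfolding combination_unique[OF area] by simp
  then have "y' = - y" using x x' \<open>a \<noteq> b\<close> a b power2_eq_iff[of y y'] by auto
  have "midpoint a b = c + x *\<^sub>R g"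
    by (simp add: midpoint_def a b \<open>x' = x\<close> \<open>y' = - y\<close> vec_eq_iff field_simps)
  moreover have "x\<^sup>2 \<le> 1" using x zero_le_power2[of y] by linarith
  then have "\<bar>x\<bar> \<le> 1" by (simp add: abs_square_le_1)
  ultimately show ?thesis using centered_segmentI by metis
qed

lemma conjugate_diameters_affine_circle:
  assumes area: "area g h \<noteq> 0"
  shows "conjugate_diameters (affine_circle c g h) (c - g) (c + g) (c - h) (c + h)"
proof -
  let ?E = "affine_circle c g h"
  have area': "area h g \<noteq> 0" using area by (simp add: area_def mult.commute)
  have ne: "g \<noteq> 0" "h \<noteq> 0" using area by (auto simp: area_def)
  have on: "c + g \<in> ?E" "c - g \<in> ?E" "c + h \<in> ?E" "c - h \<in> ?E"
    using mem_affine_circle[OF area, of c 1 0] mem_affine_circle[OF area, of c "-1" 0]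
      mem_affine_circle[OF area, of c 0 1] mem_affine_circle[OF area, of c 0 "-1"] by auto
  have diam: "ellipse_diameter ?E (c - w) (c + w)" if "c + w \<in> ?E" "c - w \<in> ?E" "w \<noteq> 0" for w
  proof -
    have "c - w \<noteq> c + w"
    proof
      assume "c - w = c + w"
      then have "2 *\<^sub>R w = 0" by (simp add: scaleR_2 algebra_simps)
      then show False using that by simp
    qed
    then show ?thesis
      using that centered_segmentI[of 0 c w]
      by (simp add: ellipse_diameter_def chord_def center_affine_circle[OF area])
  qed
  show ?thesis unfolding conjugate_diameters_def
    using diam[of g] diam[of h] on ne parallel_chord_bisected[OF area]
      parallel_chord_bisected[OF area'] affine_circle_commute[of c h g] by metis
qed

lemma conjugate_diameters_commute:
  "conjugate_diameters E p q r s \<Longrightarrow> conjugate_diameters E r s p q"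
  by (auto simp: conjugate_diameters_def)

section \<open>Directional constants\<close>

lemma has_direction_scaled:
  assumes M: "has_direction p q M" and \<kappa>: "s - r = \<kappa> *\<^sub>R (q - p)" "\<kappa> \<noteq> 0"
  shows "has_direction r s M"
proof -
  obtain \<theta> where pq: "p \<noteq> q" "q - p = dist p q *\<^sub>R vector [cos \<theta>, sin \<theta>]" "M = directional_constant \<theta>"
    using M by (auto simp: has_direction_def)
  have "dist r s = norm (s - r)" by (simp add: dist_norm norm_minus_commute)
  also have "\<dots> = \<bar>\<kappa>\<bar> * dist p q" by (simp add: \<kappa>(1) dist_norm norm_minus_commute)
  finally have d: "dist r s = \<bar>\<kappa>\<bar> * dist p q" .
  have "r \<noteq> s" using pq(1) \<kappa> by auto
  have sr: "s - r = (\<kappa> * dist p q) *\<^sub>R vector [cos \<theta>, sin \<theta>]"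
    using \<kappa>(1) pq(2) by (metis scaleR_scaleR)
  show ?thesis
  proof (cases "\<kappa> > 0")
    case True
    then show ?thesis using sr d \<open>r \<noteq> s\<close> pq(3) unfolding has_direction_def by auto
  next
    case False
    \<comment> \<open>Reversing a vector adds \<open>pi\<close> to its angle, which does not change the directional constant.\<close>
    have "s - r = dist r s *\<^sub>R vector [cos (\<theta> + pi), sin (\<theta> + pi)]"
      using False sr d by (simp add: vec_eq_iff forall_2)
    moreover have "M = directional_constant (\<theta> + pi)"
      by (simp add: pq(3) directional_constant_def)
    ultimately show ?thesis using \<open>r \<noteq> s\<close> unfolding has_direction_def by blast
  qed
qed

text \<open>Equal directional constants mean that the angles differ by a multiple of \<open>pi\<close>; then the cosine
  \<open>\<epsilon>\<close> of the difference is a sign that relates the two unit vectors.\<close>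

lemma same_direction_imp_scaled:
  assumes "has_direction p q M" "has_direction r s M"
  obtains \<kappa> where "s - r = \<kappa> *\<^sub>R (q - p)" "\<kappa> \<noteq> 0"
proof -
  obtain \<theta> where 1: "p \<noteq> q" "q - p = dist p q *\<^sub>R vector [cos \<theta>, sin \<theta>]" "M = directional_constant \<theta>"
    using assms(1) by (auto simp: has_direction_def)
  obtain \<phi> where 2: "r \<noteq> s" "s - r = dist r s *\<^sub>R vector [cos \<phi>, sin \<phi>]" "M = directional_constant \<phi>"
    using assms(2) by (auto simp: has_direction_def)
  have "sin \<phi> * cos \<theta> = cos \<phi> * sin \<theta>"
    using 1(3) 2(3) by (auto simp: directional_constant_def tan_def field_simps split: if_splits)
  then have z: "sin (\<phi> - \<theta>) = 0" by (simp add: sin_diff)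
  define \<epsilon> where "\<epsilon> = cos (\<phi> - \<theta>)"
  have "cos \<phi> = \<epsilon> * cos \<theta>" "sin \<phi> = \<epsilon> * sin \<theta>"
    using cos_add[of "\<phi> - \<theta>" \<theta>] sin_add[of "\<phi> - \<theta>" \<theta>] z by (simp_all add: \<epsilon>_def)
  then have "(vector [cos \<phi>, sin \<phi>] :: real^2) = \<epsilon> *\<^sub>R vector [cos \<theta>, sin \<theta>]"
    by (simp add: vec_eq_iff forall_2)
  then have "s - r = (dist r s * \<epsilon> / dist p q) *\<^sub>R (dist p q *\<^sub>R vector [cos \<theta>, sin \<theta>])"
    using 1(1) 2(2) by simp
  then have "s - r = (dist r s * \<epsilon> / dist p q) *\<^sub>R (q - p)"
    using 1(2) by simp
  moreover from this have "dist r s * \<epsilon> / dist p q \<noteq> 0" using 2(1) by auto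
  ultimately show thesis using that by blast
qed

lemma equal_conjugate_directions_commute:
  "equal_conjugate_directions E M\<^sub>1 M\<^sub>2 \<Longrightarrow> equal_conjugate_directions E M\<^sub>2 M\<^sub>1"
  unfolding equal_conjugate_directions_def by (metis conjugate_diameters_commute)

text \<open>An ellipse has only one diameter in each direction, so a pair of diameters with the directions of
  \<open>g\<close> and \<open>h\<close> has the lengths \<open>2 * norm g\<close> and \<open>2 * norm h\<close>.\<close>

lemma equal_conjugate_directions_affine_circle:
  assumes area: "area g h \<noteq> 0"
    and M: "has_direction 0 g M\<^sub>1" "has_direction 0 h M\<^sub>2"
  shows "equal_conjugate_directions (affine_circle c g h) M\<^sub>1 M\<^sub>2 \<longleftrightarrow> norm g = norm h"
proof
  assume "equal_conjugate_directions (affine_circle c g h) M\<^sub>1 M\<^sub>2"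
  then obtain p q r s where pq: "conjugate_diameters (affine_circle c g h) p q r s"
    "dist p q = dist r s" "has_direction p q M\<^sub>1" "has_direction r s M\<^sub>2"
    by (auto simp: equal_conjugate_directions_def)
  obtain x y x' y' where 1: "x\<^sup>2 + y\<^sup>2 = 1" "q - p = 2 *\<^sub>R (x *\<^sub>R g + y *\<^sub>R h)"
    "x'\<^sup>2 + y'\<^sup>2 = 1" "s - r = 2 *\<^sub>R (x' *\<^sub>R g + y' *\<^sub>R h)"
    using conjugate_semidiameters_perpendicular[OF area pq(1)] by metis
  obtain \<kappa> where "q - p = \<kappa> *\<^sub>R (g - 0)" using same_direction_imp_scaled[OF M(1) pq(3)] .
  then have "(2 * x) *\<^sub>R g + (2 * y) *\<^sub>R h = \<kappa> *\<^sub>R g + 0 *\<^sub>R h"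
    using 1(2) by (simp add: scaleR_add_right)
  then have "y = 0" unfolding combination_unique[OF area] by simp
  obtain \<kappa>' where "s - r = \<kappa>' *\<^sub>R (h - 0)" using same_direction_imp_scaled[OF M(2) pq(4)] .
  then have "(2 * x') *\<^sub>R g + (2 * y') *\<^sub>R h = 0 *\<^sub>R g + \<kappa>' *\<^sub>R h"
    using 1(4) by (simp add: scaleR_add_right)
  then have "x' = 0" unfolding combination_unique[OF area] by simp
  have "\<bar>x\<bar> = 1" "\<bar>y'\<bar> = 1" using 1(1,3) \<open>y = 0\<close> \<open>x' = 0\<close> by (simp_all add: abs_square_eq_1)
  then have "norm (q - p) = 2 * norm g" "norm (s - r) = 2 * norm h"
    using 1(2,4) \<open>y = 0\<close> \<open>x' = 0\<close> by (simp_all add: abs_mult)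
  then show "norm g = norm h" using pq(2) by (simp add: dist_norm norm_minus_commute)
next
  assume eq: "norm g = norm h"
  have d: "c + w - (c - w) = 2 *\<^sub>R (w - 0)" for w by (simp add: scaleR_2)
  have dist: "dist (c - w) (c + w) = 2 * norm w" for w
    using d[of w] by (metis dist_norm dist_commute diff_zero norm_scaleR abs_numeral)
  show "equal_conjugate_directions (affine_circle c g h) M\<^sub>1 M\<^sub>2"
    unfolding equal_conjugate_directions_def
    using conjugate_diameters_affine_circle[OF area, of c] has_direction_scaled[OF M(1) d]
      has_direction_scaled[OF M(2) d] eq dist by fastforce
qed

section \<open>Coordinates along the diagonals of a quadrilateral\<close>

text \<open>If \<open>z\<close> divides the segment in the ratio \<open>u\<close> to \<open>1 - u\<close>, the unit \<open>norm e\<close> has to be the geometric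
  mean of the two parts, which forces \<open>s\<^sup>2 = u / (1 - u)\<close>.\<close>

lemma chord_through_point:
  fixes a b z :: "real^2"
  assumes z: "z \<in> closed_segment a b" "z \<noteq> a" "z \<noteq> b"
  obtains e s where "s > 0" "a = z + s *\<^sub>R e" "b = z - (1 / s) *\<^sub>R e"
proof -
  obtain u where u: "0 \<le> u" "u \<le> 1" "z = (1 - u) *\<^sub>R a + u *\<^sub>R b"
    using z(1) by (auto simp: in_segment)
  have "u \<noteq> 0" "u \<noteq> 1" using u(3) z(2,3) by auto
  with u have u01: "0 < u" "u < 1" by auto
  define s where "s = sqrt (u / (1 - u))"
  have s: "s > 0" "s\<^sup>2 = u / (1 - u)" using u01 by (simp_all add: s_def)
  have diff: "a - z = u *\<^sub>R (a - b)" "z - b = (1 - u) *\<^sub>R (a - b)"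
    unfolding u(3) by (simp_all add: algebra_simps)
  have coeff: "s * (u / s) = u" "1 / s * (u / s) = u / s\<^sup>2" "u / s\<^sup>2 = 1 - u"
    using s u01 by (simp_all add: power2_eq_square)
  have "a = z + s *\<^sub>R ((u / s) *\<^sub>R (a - b))" "b = z - (1 / s) *\<^sub>R ((u / s) *\<^sub>R (a - b))"
    unfolding scaleR_scaleR coeff diff[symmetric] by simp_all
  then show thesis using that s(1) by blast
qed

lemma polytope_eq_hull_vertices: "polytope R \<Longrightarrow> R = convex hull (vertices R)"
  unfolding vertices_def
  by (rule Krein_Milman_Minkowski[OF polytope_imp_compact polytope_imp_convex])

text \<open>Radon's theorem splits the four vertices into two sets whose convex hulls meet. No vertex lies in the
  convex hull of others, so neither set is a singleton: both consist of two vertices, the endpoints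
  of a diagonal.\<close>

lemma diagonals_cross:
  assumes R: "convex_quadrilateral R"
  obtains z a b c d where "vertices R = {a, b, c, d}"
    "z \<in> closed_segment a b" "z \<in> closed_segment c d" "z \<notin> vertices R"
proof -
  define V where "V = vertices R"
  have poly: "polytope R" and card: "card V = 4" using R by (auto simp: convex_quadrilateral_def V_def)
  have fin: "finite V" using card by (metis card.infinite zero_neq_numeral)
  have hull: "R = convex hull V" unfolding V_def by (rule polytope_eq_hull_vertices[OF poly])
  have extreme: "x \<notin> convex hull T" if "x \<in> V" "T \<subseteq> V - {x}" for x T
  proof
    assume "x \<in> convex hull T"
    then have "x \<in> convex hull (V - {x})" using that(2) hull_mono by blast
    then have "convex hull (V - {x}) = R"
      using hull_redundant[of x convex "V - {x}"] that(1) hull by (simp add: insert_absorb)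
    then have "x \<in> V - {x}"
      using extreme_point_of_convex_hull[of x "V - {x}"] that(1) by (simp add: V_def vertices_def)
    then show False by simp
  qed
  have "affine_dependent V" using fin card by (intro affine_dependent_biggerset) auto
  then obtain M P where MP: "M \<subseteq> V" "P \<subseteq> V" "M \<inter> P = {}" "convex hull M \<inter> convex hull P \<noteq> {}"
    by (rule Radon)
  have big: "card M \<ge> 2" if MP: "M \<subseteq> V" "P \<subseteq> V" "M \<inter> P = {}" "convex hull M \<inter> convex hull P \<noteq> {}" for M P
  proof (rule ccontr)
    assume "\<not> card M \<ge> 2"
    moreover have "M \<noteq> {}" using MP(4) by auto
    moreover have "finite M" using MP(1) fin finite_subset by blast
    ultimately have "card M = 1" using card_gt_0_iff[of M] by linarith
    then obtain x where "M = {x}" by (auto simp: card_1_singleton_iff)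
    moreover from this have "x \<in> convex hull P" using MP(4) by auto
    ultimately show False using extreme[of x P] MP by blast
  qed
  have finMP: "finite M" "finite P" using MP(1,2) fin finite_subset by blast+
  have "card M \<ge> 2" "card P \<ge> 2" using big[OF MP] big[of P M] MP by (auto simp: Int_commute)
  moreover have "card M + card P = card (M \<union> P)" using card_Un_disjoint[OF finMP MP(3)] by simp
  moreover have "card (M \<union> P) \<le> 4" using card_mono[OF fin, of "M \<union> P"] MP card by simp
  ultimately have cards: "card M = 2" "card P = 2" "card (M \<union> P) = card V" using card by auto
  have V: "M \<union> P = V" using cards(3) MP fin by (intro card_subset_eq) auto
  obtain a b c d where ab: "M = {a, b}" and cd: "P = {c, d}" using cards by (auto simp: card_2_iff)
  obtain z where z: "z \<in> convex hull M" "z \<in> convex hull P" using MP(4) by blast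
  have "z \<notin> V" using extreme[of z P] extreme[of z M] z MP V by blast
  moreover have "vertices R = {a, b, c, d}" using V ab cd V_def by auto
  ultimately show thesis
    using that[of a b c d z] z V_def ab cd by (simp add: segment_convex_hull)
qed

text \<open>A compact convex subset of a line is a segment, which has at most two extreme points.\<close>

lemma vertices_not_collinear:
  assumes R: "convex_quadrilateral R"
  shows "\<not> collinear (vertices R)"
proof
  assume col: "collinear (vertices R)"
  have poly: "polytope R" and card: "card (vertices R) = 4"
    using R by (auto simp: convex_quadrilateral_def)
  have hull: "R = convex hull (vertices R)" by (rule polytope_eq_hull_vertices[OF poly])
  have "R \<subseteq> affine hull (vertices R)"
    using hull convex_hull_subset_affine_hull by (rule ord_eq_le_trans)
  then have "collinear R"
    using col collinear_affine_hull_collinear collinear_subset by blast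
  moreover have "R \<noteq> {}" using card by (auto simp: vertices_def extreme_point_of_def)
  ultimately obtain a b where "R = closed_segment a b"
    using compact_convex_collinear_segment polytope_imp_compact[OF poly] polytope_imp_convex[OF poly] by metis
  then have "vertices R = {a, b}" by (auto simp: vertices_def extreme_point_of_segment)
  then show False using card by (simp add: card_insert_if split: if_splits)
qed

lemma quadrilateral_normal_form:
  assumes R: "convex_quadrilateral R"
  obtains z e f s t where "area e f \<noteq> 0" "s > 0" "t > 0"
    "vertices R = {z + s *\<^sub>R e, z - (1 / s) *\<^sub>R e, z + t *\<^sub>R f, z - (1 / t) *\<^sub>R f}"
proof -
  obtain z a b c d where V: "vertices R = {a, b, c, d}" and z: "z \<in> closed_segment a b"
    "z \<in> closed_segment c d" "z \<notin> vertices R" using diagonals_cross[OF R] .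
  have ne: "z \<noteq> a" "z \<noteq> b" "z \<noteq> c" "z \<noteq> d" using z(3) unfolding V by auto
  obtain e s where e: "s > 0" "a = z + s *\<^sub>R e" "b = z - (1 / s) *\<^sub>R e"
    using chord_through_point[OF z(1) ne(1,2)] .
  obtain f t where f: "t > 0" "c = z + t *\<^sub>R f" "d = z - (1 / t) *\<^sub>R f"
    using chord_through_point[OF z(2) ne(3,4)] .
  have "e \<noteq> 0" using e(2) ne(1) by auto
  have "area e f \<noteq> 0"
  proof
    assume "area e f = 0"
    then have "e $ 1 * f $ 2 = e $ 2 * f $ 1" by (simp add: area_def)
    then have "(e $ 1 * e $ 1 + e $ 2 * e $ 2) * f $ 1 = (e $ 1 * f $ 1 + e $ 2 * f $ 2) * e $ 1"
      "(e $ 1 * e $ 1 + e $ 2 * e $ 2) * f $ 2 = (e $ 1 * f $ 1 + e $ 2 * f $ 2) * e $ 2"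
      by algebra+
    then have "(e \<bullet> e) *\<^sub>R f = (e \<bullet> f) *\<^sub>R e" by (simp add: vec_eq_iff forall_2 inner_real2)
    then have "(1 / (e \<bullet> e)) *\<^sub>R ((e \<bullet> e) *\<^sub>R f) = (1 / (e \<bullet> e)) *\<^sub>R ((e \<bullet> f) *\<^sub>R e)" by simp
    then have "f = ((e \<bullet> f) / (e \<bullet> e)) *\<^sub>R e" using \<open>e \<noteq> 0\<close> by simp
    then obtain \<kappa> where \<kappa>: "f = \<kappa> *\<^sub>R e" by blast
    have "a = z + s *\<^sub>R e" "b = z + (- (1 / s)) *\<^sub>R e" "c = z + (t * \<kappa>) *\<^sub>R e"
      "d = z + (- (1 / t) * \<kappa>) *\<^sub>R e"
      unfolding e(2,3) f(2,3) \<kappa> by simp_all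
    then have on_line: "\<exists>x. p = z + x *\<^sub>R e" if "p \<in> vertices R" for p
      using that unfolding V by blast
    have "\<exists>x. p - q = x *\<^sub>R e" if pq: "p \<in> vertices R" "q \<in> vertices R" for p q
    proof -
      obtain x y where "p = z + x *\<^sub>R e" "q = z + y *\<^sub>R e" using on_line pq by meson
      then have "p - q = (x - y) *\<^sub>R e" by (simp add: scaleR_left_diff_distrib)
      then show ?thesis by blast
    qed
    then have "collinear (vertices R)" unfolding collinear_def by blast
    then show False using vertices_not_collinear[OF R] by blast
  qed
  from that[OF this e(1) f(1) V[unfolded e(2,3) f(2,3)]] show thesis .
qed

section \<open>The pencil of conics through the vertices\<close>

text \<open>The members of the pencil of conics through the four points, normalised by the coefficient 1 at the
  two squares; only the coefficient \<open>k\<close> of the mixed term is free.\<close>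

definition vertex_conic :: "real^2 \<Rightarrow> real^2 \<Rightarrow> real^2 \<Rightarrow> real \<Rightarrow> real \<Rightarrow> real \<Rightarrow> (real^2) set" where
  "vertex_conic z e f s t k = {z + x *\<^sub>R e + y *\<^sub>R f | x y.
     x\<^sup>2 + y\<^sup>2 + 2 * k * x * y - (s - 1 / s) * x - (t - 1 / t) * y = 1}"

lemma mem_vertex_conic:
  assumes "area e f \<noteq> 0"
  shows "z + (x *\<^sub>R e + y *\<^sub>R f) \<in> vertex_conic z e f s t k \<longleftrightarrow>
    x\<^sup>2 + y\<^sup>2 + 2 * k * x * y - (s - 1 / s) * x - (t - 1 / t) * y = 1"
  using combination_unique[OF assms] by (auto simp: vertex_conic_def add.assoc)

text \<open>Completing the square. In the coordinates \<open>X, Y\<close> with respect to \<open>e + f\<close> and \<open>e - f\<close>, centered at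
  \<open>c\<close>, the conic becomes \<open>(1 + k) * X\<^sup>2 + (1 - k) * Y\<^sup>2 = m\<close>; the constant \<open>m\<close> is positive because the
  quadratic form is positive definite and the constant term of the equation is \<open>-1\<close>.\<close>

lemma vertex_conic_as_affine_circle:
  assumes area: "area e f \<noteq> 0" and k: "\<bar>k\<bar> < 1"
  obtains c \<alpha> \<beta> where "\<alpha> > 0" "\<beta> > 0" "(1 + k) * \<alpha>\<^sup>2 = (1 - k) * \<beta>\<^sup>2"
    "vertex_conic z e f s t k = affine_circle c (\<alpha> *\<^sub>R (e + f)) (\<beta> *\<^sub>R (e - f))"
proof -
  define \<sigma> \<tau> where "\<sigma> = (s - 1 / s) / 2" and "\<tau> = (t - 1 / t) / 2"
  \<comment> \<open>The center \<open>(x0, y0)\<close> is where both partial derivatives vanish, by Cramer's rule.\<close>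
  define x0 y0 where "x0 = (\<sigma> - k * \<tau>) / (1 - k\<^sup>2)" and "y0 = (\<tau> - k * \<sigma>) / (1 - k\<^sup>2)"
  have k2: "1 - k\<^sup>2 > 0" using k by (simp add: abs_square_less_1)
  have "x0 * (1 - k\<^sup>2) = \<sigma> - k * \<tau>" "y0 * (1 - k\<^sup>2) = \<tau> - k * \<sigma>"
    using k2 by (simp_all add: x0_def y0_def)
  then have "(1 - k\<^sup>2) * (x0 + k * y0) = (1 - k\<^sup>2) * \<sigma>" "(1 - k\<^sup>2) * (y0 + k * x0) = (1 - k\<^sup>2) * \<tau>"
    by algebra+
  then have center: "x0 + k * y0 = \<sigma>" "y0 + k * x0 = \<tau>"
    using k2 by simp_all
  define m where "m = (1 + x0\<^sup>2 + y0\<^sup>2 + 2 * k * x0 * y0) / 2"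
  have "x0\<^sup>2 + y0\<^sup>2 + 2 * k * x0 * y0 = (x0 + k * y0)\<^sup>2 + (1 - k\<^sup>2) * y0\<^sup>2" by algebra
  also have "\<dots> \<ge> 0" using k2 by simp
  finally have m: "m > 0" by (simp add: m_def)
  define \<alpha> \<beta> where "\<alpha> = sqrt (m / (1 + k))" and "\<beta> = sqrt (m / (1 - k))"
  have pos: "\<alpha> > 0" "\<beta> > 0" using m k by (auto simp: \<alpha>_def \<beta>_def)
  have sq: "(1 + k) * \<alpha>\<^sup>2 = m" "(1 - k) * \<beta>\<^sup>2 = m" using m k by (auto simp: \<alpha>_def \<beta>_def)
  define c where "c = z + (x0 *\<^sub>R e + y0 *\<^sub>R f)"
  define g h where "g = \<alpha> *\<^sub>R (e + f)" and "h = \<beta> *\<^sub>R (e - f)"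
  have gh: "area g h \<noteq> 0" using pos area by (simp add: g_def h_def area_scaled area_sum_diff)
  have "p \<in> vertex_conic z e f s t k \<longleftrightarrow> p \<in> affine_circle c g h" for p
  proof -
    obtain x y where p: "p = c + (x *\<^sub>R g + y *\<^sub>R h)" using point_coordinates[OF gh] .
    define X Y where "X = \<alpha> * x" and "Y = \<beta> * y"
    have p': "p = z + ((x0 + X + Y) *\<^sub>R e + (y0 + X - Y) *\<^sub>R f)"
      by (simp add: p c_def g_def h_def X_def Y_def vec_eq_iff algebra_simps)
    have "(x0 + X + Y)\<^sup>2 + (y0 + X - Y)\<^sup>2 + 2 * k * (x0 + X + Y) * (y0 + X - Y)
        - 2 * \<sigma> * (x0 + X + Y) - 2 * \<tau> * (y0 + X - Y) - 1
        = 2 * ((1 + k) * X\<^sup>2 + (1 - k) * Y\<^sup>2 - m)"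
      unfolding center[symmetric] m_def by (simp add: power2_eq_square field_simps)
    also have "\<dots> = 2 * m * (x\<^sup>2 + y\<^sup>2 - 1)"
    proof -
      have "(1 + k) * X\<^sup>2 = (1 + k) * \<alpha>\<^sup>2 * x\<^sup>2" "(1 - k) * Y\<^sup>2 = (1 - k) * \<beta>\<^sup>2 * y\<^sup>2"
        by (simp_all add: X_def Y_def power_mult_distrib)
      then show ?thesis unfolding sq by (simp add: algebra_simps)
    qed
    finally have poly: "(x0 + X + Y)\<^sup>2 + (y0 + X - Y)\<^sup>2 + 2 * k * (x0 + X + Y) * (y0 + X - Y)
        - 2 * \<sigma> * (x0 + X + Y) - 2 * \<tau> * (y0 + X - Y) - 1 = 2 * m * (x\<^sup>2 + y\<^sup>2 - 1)" .
    have "p \<in> vertex_conic z e f s t k \<longleftrightarrow> 2 * m * (x\<^sup>2 + y\<^sup>2 - 1) = 0"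
    proof -
      have st: "s - 1 / s = 2 * \<sigma>" "t - 1 / t = 2 * \<tau>" by (simp_all add: \<sigma>_def \<tau>_def)
      show ?thesis unfolding p' mem_vertex_conic[OF area] st using poly by linarith
    qed
    then show ?thesis using m unfolding p mem_affine_circle[OF gh] by simp
  qed
  then have "vertex_conic z e f s t k = affine_circle c g h" by blast
  then show thesis using that[OF pos] sq unfolding g_def h_def by metis
qed

lemma vertex_conic_contains:
  assumes "s \<noteq> 0" "t \<noteq> 0"
  shows "z + s *\<^sub>R e \<in> vertex_conic z e f s t k" "z - (1 / s) *\<^sub>R e \<in> vertex_conic z e f s t k"
    "z + t *\<^sub>R f \<in> vertex_conic z e f s t k" "z - (1 / t) *\<^sub>R f \<in> vertex_conic z e f s t k"
  unfolding vertex_conic_def mem_Collect_eq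
  subgoal by (intro exI[of _ s] exI[of _ 0]) (use assms in \<open>simp add: power2_eq_square field_simps\<close>)
  subgoal by (intro exI[of _ "- (1 / s)"] exI[of _ 0]) (use assms in \<open>simp add: power2_eq_square field_simps\<close>)
  subgoal by (intro exI[of _ 0] exI[of _ t]) (use assms in \<open>simp add: power2_eq_square field_simps\<close>)
  subgoal by (intro exI[of _ 0] exI[of _ "- (1 / t)"]) (use assms in \<open>simp add: power2_eq_square field_simps\<close>)
  done

text \<open>A pair of conjugate directions, written in the basis \<open>e + f\<close>, \<open>e - f\<close>, is orthogonal for the
  diagonal form with entries \<open>1 + k\<close> and \<open>1 - k\<close>.\<close>

lemma vertex_conic_conjugate_directions:
  assumes area: "area e f \<noteq> 0" and k: "\<bar>k\<bar> < 1"
    and conj: "conjugate_directions (vertex_conic z e f s t k) M\<^sub>1 M\<^sub>2"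
  obtains x y x' y' where "has_direction 0 (x *\<^sub>R (e + f) + y *\<^sub>R (e - f)) M\<^sub>1"
    "has_direction 0 (x' *\<^sub>R (e + f) + y' *\<^sub>R (e - f)) M\<^sub>2"
    "(1 + k) * (x * x') + (1 - k) * (y * y') = 0"
proof -
  obtain c \<alpha> \<beta> where pos: "\<alpha> > 0" "\<beta> > 0" and sq: "(1 + k) * \<alpha>\<^sup>2 = (1 - k) * \<beta>\<^sup>2"
    and E: "vertex_conic z e f s t k = affine_circle c (\<alpha> *\<^sub>R (e + f)) (\<beta> *\<^sub>R (e - f))"
    using vertex_conic_as_affine_circle[OF area k] .
  have gh: "area (\<alpha> *\<^sub>R (e + f)) (\<beta> *\<^sub>R (e - f)) \<noteq> 0"
    using pos area by (simp add: area_scaled area_sum_diff)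
  obtain p q r w where pq: "conjugate_diameters (vertex_conic z e f s t k) p q r w"
    "has_direction p q M\<^sub>1" "has_direction r w M\<^sub>2"
    using conj by (auto simp: conjugate_directions_def)
  obtain x y x' y' where
    1: "q - p = 2 *\<^sub>R (x *\<^sub>R (\<alpha> *\<^sub>R (e + f)) + y *\<^sub>R (\<beta> *\<^sub>R (e - f)))" and
    2: "w - r = 2 *\<^sub>R (x' *\<^sub>R (\<alpha> *\<^sub>R (e + f)) + y' *\<^sub>R (\<beta> *\<^sub>R (e - f)))" and
    3: "x * x' + y * y' = 0"
    using conjugate_semidiameters_perpendicular[OF gh pq(1)[unfolded E]] by metis
  show thesis
  proof (rule that)
    show "has_direction 0 ((x * \<alpha>) *\<^sub>R (e + f) + (y * \<beta>) *\<^sub>R (e - f)) M\<^sub>1"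
      by (rule has_direction_scaled[OF pq(2), of _ _ "1 / 2"]) (simp_all add: 1)
    show "has_direction 0 ((x' * \<alpha>) *\<^sub>R (e + f) + (y' * \<beta>) *\<^sub>R (e - f)) M\<^sub>2"
      by (rule has_direction_scaled[OF pq(3), of _ _ "1 / 2"]) (simp_all add: 2)
    have "(1 + k) * (x * \<alpha> * (x' * \<alpha>)) + (1 - k) * (y * \<beta> * (y' * \<beta>))
        = (1 + k) * \<alpha>\<^sup>2 * (x * x' + y * y')" using sq by algebra
    also have "\<dots> = 0" using 3 by simp
    finally show "(1 + k) * (x * \<alpha> * (x' * \<alpha>)) + (1 - k) * (y * \<beta> * (y' * \<beta>)) = 0" .
  qed
qed

text \<open>Uniqueness in Steiner's theorem. The condition of the preceding lemma is linear in \<open>k\<close>, so the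
  values \<open>0\<close> and \<open>1 / 2\<close> already give \<open>x * x' = 0\<close> and \<open>y * y' = 0\<close>.\<close>

lemma common_conjugate_directions:
  assumes area: "area e f \<noteq> 0"
    and all: "\<And>k. \<bar>k\<bar> < 1 \<Longrightarrow> conjugate_directions (vertex_conic z e f s t k) M\<^sub>1 M\<^sub>2"
  shows "has_direction 0 (e + f) M\<^sub>1 \<and> has_direction 0 (e - f) M\<^sub>2 \<or>
    has_direction 0 (e - f) M\<^sub>1 \<and> has_direction 0 (e + f) M\<^sub>2"
proof -
  have gh: "area (e + f) (e - f) \<noteq> 0" using area by (simp add: area_sum_diff)
  obtain x y x' y' where 0: "has_direction 0 (x *\<^sub>R (e + f) + y *\<^sub>R (e - f)) M\<^sub>1"
    "has_direction 0 (x' *\<^sub>R (e + f) + y' *\<^sub>R (e - f)) M\<^sub>2" "x * x' + y * y' = 0"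
    by (rule vertex_conic_conjugate_directions[OF area, of 0, OF _ all]) auto
  obtain X Y X' Y' where 1: "has_direction 0 (X *\<^sub>R (e + f) + Y *\<^sub>R (e - f)) M\<^sub>1"
    "has_direction 0 (X' *\<^sub>R (e + f) + Y' *\<^sub>R (e - f)) M\<^sub>2"
    "(1 + 1 / 2) * (X * X') + (1 - 1 / 2) * (Y * Y') = 0"
    by (rule vertex_conic_conjugate_directions[OF area, of "1 / 2", OF _ all]) auto
  obtain \<kappa> where "X *\<^sub>R (e + f) + Y *\<^sub>R (e - f) - 0 = \<kappa> *\<^sub>R (x *\<^sub>R (e + f) + y *\<^sub>R (e - f) - 0)"
    and \<kappa>: "\<kappa> \<noteq> 0" using same_direction_imp_scaled[OF 0(1) 1(1)] .
  then have "X *\<^sub>R (e + f) + Y *\<^sub>R (e - f) = (\<kappa> * x) *\<^sub>R (e + f) + (\<kappa> * y) *\<^sub>R (e - f)"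
    by (simp only: diff_zero scaleR_add_right[of \<kappa> "x *\<^sub>R (e + f)"] scaleR_scaleR)
  then have X: "X = \<kappa> * x" "Y = \<kappa> * y" unfolding combination_unique[OF gh] by auto
  obtain \<kappa>' where "X' *\<^sub>R (e + f) + Y' *\<^sub>R (e - f) - 0 = \<kappa>' *\<^sub>R (x' *\<^sub>R (e + f) + y' *\<^sub>R (e - f) - 0)"
    and \<kappa>': "\<kappa>' \<noteq> 0" using same_direction_imp_scaled[OF 0(2) 1(2)] .
  then have "X' *\<^sub>R (e + f) + Y' *\<^sub>R (e - f) = (\<kappa>' * x') *\<^sub>R (e + f) + (\<kappa>' * y') *\<^sub>R (e - f)"
    by (simp only: diff_zero scaleR_add_right[of \<kappa>' "x' *\<^sub>R (e + f)"] scaleR_scaleR)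
  then have X': "X' = \<kappa>' * x'" "Y' = \<kappa>' * y'" unfolding combination_unique[OF gh] by auto
  have "\<kappa> * \<kappa>' * (3 * (x * x') + y * y') = 0" using 1(3) unfolding X X' by (simp add: algebra_simps)
  then have "3 * (x * x') + y * y' = 0" using \<kappa> \<kappa>' by simp
  then have prods: "x * x' = 0" "y * y' = 0" using 0(3) by linarith+
  have nz: "x \<noteq> 0 \<or> y \<noteq> 0" "x' \<noteq> 0 \<or> y' \<noteq> 0"
    using 0(1,2) by (auto simp: has_direction_def)
  have single: "has_direction 0 w M" if "has_direction 0 (a *\<^sub>R w) M" for a w M
  proof -
    have "a \<noteq> 0" using that by (auto simp: has_direction_def)
    then show ?thesis using has_direction_scaled[OF that, of w 0 "1 / a"] by simp
  qed
  consider "x = 0" "y' = 0" | "y = 0" "x' = 0" using prods nz by auto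
  then show ?thesis
  proof cases
    case 1
    then show ?thesis using 0(1,2) single by auto
  next
    case 2
    then show ?thesis using 0(1,2) single by auto
  qed
qed

text \<open>A quadratic polynomial with the roots \<open>s\<close> and \<open>- 1 / s\<close> is a multiple of
  \<open>x\<^sup>2 - (s - 1 / s) * x - 1\<close>.\<close>

lemma quadratic_with_roots:
  fixes A D F s :: real
  assumes "s > 0" "A * s\<^sup>2 + D * s + F = 0" "A / s\<^sup>2 - D / s + F = 0"
  shows "F = - A" "D = - A * (s - 1 / s)"
proof -
  have "A - D * s + F * s\<^sup>2 = 0" using assms by (simp add: field_simps power2_eq_square)
  then have "(F + A) * (1 + s\<^sup>2) = 0" using assms(2) by algebra
  moreover have "1 + s\<^sup>2 \<noteq> 0" using zero_le_power2[of s] by linarith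
  ultimately show F: "F = - A" by simp
  show "D = - A * (s - 1 / s)" using assms(1,2) F by (simp add: field_simps power2_eq_square)
qed

text \<open>Write the equation of the ellipse in the coordinates with respect to \<open>e\<close> and \<open>f\<close>. Its restrictions
  to the two axes have known roots and share the constant term, which determines all coefficients,
  up to a common factor, except for that of the mixed term. The positive discriminant of the
  quadratic part bounds this last coefficient.\<close>

lemma ellipse_through_vertices:
  assumes area: "area e f \<noteq> 0" and st: "s > 0" "t > 0" and E: "ellipse E"
    and through: "z + s *\<^sub>R e \<in> E" "z - (1 / s) *\<^sub>R e \<in> E" "z + t *\<^sub>R f \<in> E" "z - (1 / t) *\<^sub>R f \<in> E"
  obtains k where "\<bar>k\<bar> < 1" "E = vertex_conic z e f s t k"
proof -
  obtain c a b u v where ab: "a \<ge> b" "b > 0" and uv: "norm u = 1" "norm v = 1" "u \<bullet> v = 0"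
    and Eq: "E = {p. (u \<bullet> (p - c) / a)\<^sup>2 + (v \<bullet> (p - c) / b)\<^sup>2 = 1}"
    using E unfolding ellipse_def ellipse_with_def by blast
  define u0 u1 u2 where "u0 = u \<bullet> (z - c) / a" and "u1 = u \<bullet> e / a" and "u2 = u \<bullet> f / a"
  define v0 v1 v2 where "v0 = v \<bullet> (z - c) / b" and "v1 = v \<bullet> e / b" and "v2 = v \<bullet> f / b"
  have mem: "z + (x *\<^sub>R e + y *\<^sub>R f) \<in> E \<longleftrightarrow> (u0 + u1 * x + u2 * y)\<^sup>2 + (v0 + v1 * x + v2 * y)\<^sup>2 = 1" for x y
  proof -
    have eq: "z + (x *\<^sub>R e + y *\<^sub>R f) - c = (z - c) + x *\<^sub>R e + y *\<^sub>R f" by simp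
    show ?thesis unfolding Eq mem_Collect_eq eq
      by (simp add: u0_def u1_def u2_def v0_def v1_def v2_def inner_add_right add_divide_distrib mult.commute)
  qed
  define A B C D G F where "A = u1\<^sup>2 + v1\<^sup>2" and "B = u1 * u2 + v1 * v2" and "C = u2\<^sup>2 + v2\<^sup>2"
    and "D = 2 * (u0 * u1 + v0 * v1)" and "G = 2 * (u0 * u2 + v0 * v2)" and "F = u0\<^sup>2 + v0\<^sup>2 - 1"
  have mem': "z + (x *\<^sub>R e + y *\<^sub>R f) \<in> E \<longleftrightarrow>
      A * x\<^sup>2 + 2 * B * x * y + C * y\<^sup>2 + D * x + G * y + F = 0" for x y
  proof -
    have "(u0 + u1 * x + u2 * y)\<^sup>2 + (v0 + v1 * x + v2 * y)\<^sup>2 - 1 =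
        A * x\<^sup>2 + 2 * B * x * y + C * y\<^sup>2 + D * x + G * y + F"
      unfolding A_def B_def C_def D_def G_def F_def by algebra
    then show ?thesis unfolding mem by linarith
  qed
  have "F = - A" "D = - A * (s - 1 / s)"
    using quadratic_with_roots[OF st(1), of A D F] through(1,2) mem'[of s 0] mem'[of "- (1 / s)" 0]
    by (simp_all add: power_divide)
  moreover have "F = - C" "G = - C * (t - 1 / t)"
    using quadratic_with_roots[OF st(2), of C G F] through(3,4) mem'[of 0 t] mem'[of 0 "- (1 / t)"]
    by (simp_all add: power_divide)
  ultimately have co: "F = - A" "C = A" "D = - A * (s - 1 / s)" "G = - A * (t - 1 / t)" by auto
  \<comment> \<open>The discriminant \<open>A * C - B\<^sup>2\<close> is the square of the determinant \<open>u1 * v2 - u2 * v1\<close> (Lagrange),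
      which is nonzero by the Binet-Cauchy identity.\<close>
  have "u1 * v2 - u2 * v1 = ((u \<bullet> e) * (v \<bullet> f) - (u \<bullet> f) * (v \<bullet> e)) / (a * b)"
    using ab by (simp add: u1_def u2_def v1_def v2_def diff_divide_distrib)
  also have "(u \<bullet> e) * (v \<bullet> f) - (u \<bullet> f) * (v \<bullet> e) = area u v * area e f"
    by (simp add: inner_real2 area_def algebra_simps)
  finally have "u1 * v2 - u2 * v1 = area u v * area e f / (a * b)" .
  moreover have "(area u v)\<^sup>2 = 1" using uv by (simp add: area_squared dot_square_norm)
  then have "area u v \<noteq> 0" by auto
  ultimately have "u1 * v2 - u2 * v1 \<noteq> 0" using area ab by simp
  then have "(u1 * v2 - u2 * v1)\<^sup>2 > 0" by simp
  also have "(u1 * v2 - u2 * v1)\<^sup>2 = A * C - B\<^sup>2" unfolding A_def B_def C_def by algebra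
  finally have disc: "B\<^sup>2 < A\<^sup>2" using co by (simp add: power2_eq_square)
  have "A \<ge> 0" by (simp add: A_def)
  moreover have "A \<noteq> 0" using disc by auto
  ultimately have A: "A > 0" by simp
  define k where "k = B / A"
  have "\<bar>B\<bar> < A" using disc A by (intro power2_less_imp_less[of "\<bar>B\<bar>" A]) auto
  then have "\<bar>k\<bar> < 1" using A by (simp add: k_def)
  moreover have "p \<in> E \<longleftrightarrow> p \<in> vertex_conic z e f s t k" for p
  proof -
    obtain x y where p: "p = z + (x *\<^sub>R e + y *\<^sub>R f)" using point_coordinates[OF area] .
    have B: "B = A * k" using A by (simp add: k_def)
    have "A * x\<^sup>2 + 2 * B * x * y + C * y\<^sup>2 + D * x + G * y + F
        = A * (x\<^sup>2 + y\<^sup>2 + 2 * k * x * y - (s - 1 / s) * x - (t - 1 / t) * y - 1)"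
      unfolding co B by (simp add: algebra_simps)
    then show ?thesis unfolding p mem' mem_vertex_conic[OF area] using A by simp
  qed
  ultimately show thesis using that by blast
qed

section \<open>The circumscribed ellipse of minimal eccentricity\<close>

theorem theorem1:
  fixes R :: "(real^2) set" and M\<^sub>1 M\<^sub>2 :: ereal
  assumes "convex_quadrilateral R" and "\<not> trapezoid R"
    and "\<And>E. circumscribed_ellipse R E \<Longrightarrow> conjugate_directions E M\<^sub>1 M\<^sub>2"
  shows "\<exists>E\<^sub>O.
      (circumscribed_ellipse R E\<^sub>O \<and> equal_conjugate_directions E\<^sub>O M\<^sub>1 M\<^sub>2) \<and>
      (\<forall>E. circumscribed_ellipse R E \<and> equal_conjugate_directions E M\<^sub>1 M\<^sub>2 \<longrightarrow> E = E\<^sub>O) \<and>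
      is_arg_min eccentricity (circumscribed_ellipse R) E\<^sub>O \<and>
      (\<forall>E. is_arg_min eccentricity (circumscribed_ellipse R) E \<longrightarrow> E = E\<^sub>O)"
proof -
  obtain z e f s t where area: "area e f \<noteq> 0" and st: "s > 0" "t > 0"
    and V: "vertices R = {z + s *\<^sub>R e, z - (1 / s) *\<^sub>R e, z + t *\<^sub>R f, z - (1 / t) *\<^sub>R f}"
    using quadrilateral_normal_form[OF assms(1)] .
  have GH: "area (e + f) (e - f) \<noteq> 0" using area by (simp add: area_sum_diff)
  define conic where "conic = vertex_conic z e f s t"
  have param: "\<exists>c \<alpha> \<beta>. conic k = affine_circle c (\<alpha> *\<^sub>R (e + f)) (\<beta> *\<^sub>R (e - f)) \<and> \<alpha> > 0 \<and> \<beta> > 0 \<and>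
      (1 + k) * \<alpha>\<^sup>2 = (1 - k) * \<beta>\<^sup>2" if k: "\<bar>k\<bar> < 1" for k
    unfolding conic_def by (rule vertex_conic_as_affine_circle[OF area k]) blast
  have circ_iff: "circumscribed_ellipse R E \<longleftrightarrow> (\<exists>k. \<bar>k\<bar> < 1 \<and> E = conic k)" for E
  proof
    assume "circumscribed_ellipse R E"
    then have E: "ellipse E" and through: "z + s *\<^sub>R e \<in> E" "z - (1 / s) *\<^sub>R e \<in> E"
      "z + t *\<^sub>R f \<in> E" "z - (1 / t) *\<^sub>R f \<in> E"
      by (simp_all add: circumscribed_ellipse_def V)
    obtain k where "\<bar>k\<bar> < 1" "E = conic k"
      unfolding conic_def by (rule ellipse_through_vertices[OF area st E through])
    then show "\<exists>k. \<bar>k\<bar> < 1 \<and> E = conic k" by blast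
  next
    assume "\<exists>k. \<bar>k\<bar> < 1 \<and> E = conic k"
    then obtain k where k: "\<bar>k\<bar> < 1" "E = conic k" by blast
    obtain c \<alpha> \<beta> where "conic k = affine_circle c (\<alpha> *\<^sub>R (e + f)) (\<beta> *\<^sub>R (e - f))" "\<alpha> > 0" "\<beta> > 0"
      using param[OF k(1)] by blast
    then have "ellipse E" using k(2) GH ellipse_affine_circle[of "\<alpha> *\<^sub>R (e + f)" "\<beta> *\<^sub>R (e - f)" c]
      by (simp add: area_scaled)
    moreover have "vertices R \<subseteq> E"
      unfolding V k(2) conic_def using vertex_conic_contains[of s t] st by (intro insert_subsetI empty_subsetI) auto
    ultimately show "circumscribed_ellipse R E" by (simp add: circumscribed_ellipse_def)
  qed
  define P N where "P = (norm (e + f))\<^sup>2" and "N = (norm (e - f))\<^sup>2"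
  have zero: "area 0 w = 0" "area w 0 = 0" for w by (simp_all add: area_def)
  have "e + f \<noteq> 0" "e - f \<noteq> 0" using GH zero by metis+
  then have PN: "P > 0" "N > 0" unfolding P_def N_def by (simp_all only: zero_less_power zero_less_norm_iff not_False_eq_True)
  \<comment> \<open>The solution of \<open>(1 - k) * P = (1 + k) * N\<close>, the condition that the two semidiameters have
      equal length.\<close>
  define k0 where "k0 = (P - N) / (P + N)"
  have k0: "\<bar>k0\<bar> < 1" using PN by (simp add: k0_def)
  have balanced: "norm (\<alpha> *\<^sub>R (e + f)) = norm (\<beta> *\<^sub>R (e - f)) \<longleftrightarrow> k = k0"
    if k: "\<bar>k\<bar> < 1" and ab: "\<alpha> > 0" "\<beta> > 0" "(1 + k) * \<alpha>\<^sup>2 = (1 - k) * \<beta>\<^sup>2" for k \<alpha> \<beta>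
  proof -
    have pos: "1 + k > 0" using k by linarith
    have \<alpha>: "(1 + k) * (\<alpha>\<^sup>2 * P) = \<beta>\<^sup>2 * ((1 - k) * P)"
      by (metis ab(3) mult.assoc mult.commute)
    have \<beta>: "(1 + k) * (\<beta>\<^sup>2 * N) = \<beta>\<^sup>2 * ((1 + k) * N)" by simp
    have "norm (\<alpha> *\<^sub>R (e + f)) = norm (\<beta> *\<^sub>R (e - f)) \<longleftrightarrow>
        (norm (\<alpha> *\<^sub>R (e + f)))\<^sup>2 = (norm (\<beta> *\<^sub>R (e - f)))\<^sup>2"
      by (rule power2_eq_iff_nonneg[symmetric]) simp_all
    also have "\<dots> \<longleftrightarrow> \<alpha>\<^sup>2 * P = \<beta>\<^sup>2 * N" by (simp add: power_mult_distrib P_def N_def)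
    also have "\<dots> \<longleftrightarrow> (1 + k) * (\<alpha>\<^sup>2 * P) = (1 + k) * (\<beta>\<^sup>2 * N)" using pos by simp
    also have "\<dots> \<longleftrightarrow> (1 - k) * P = (1 + k) * N" unfolding \<alpha> \<beta> using ab(2) by simp
    also have "\<dots> \<longleftrightarrow> k * (P + N) = P - N" by (auto simp: algebra_simps)
    also have "\<dots> \<longleftrightarrow> k = k0" using PN by (simp add: k0_def eq_divide_eq)
    finally show ?thesis .
  qed
  have equal_iff: "equal_conjugate_directions (conic k) M\<^sub>1 M\<^sub>2 \<longleftrightarrow> k = k0" if k: "\<bar>k\<bar> < 1" for k
  proof -
    obtain c \<alpha> \<beta> where E: "conic k = affine_circle c (\<alpha> *\<^sub>R (e + f)) (\<beta> *\<^sub>R (e - f))"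
      and ab: "\<alpha> > 0" "\<beta> > 0" "(1 + k) * \<alpha>\<^sup>2 = (1 - k) * \<beta>\<^sup>2" using param[OF k] by blast
    have gh: "area (\<alpha> *\<^sub>R (e + f)) (\<beta> *\<^sub>R (e - f)) \<noteq> 0" using GH ab by (simp add: area_scaled)
    have *: "equal_conjugate_directions (conic k) M M' \<longleftrightarrow> k = k0"
      if M: "has_direction 0 (e + f) M" "has_direction 0 (e - f) M'" for M M'
    proof -
      have "has_direction 0 (\<alpha> *\<^sub>R (e + f)) M" "has_direction 0 (\<beta> *\<^sub>R (e - f)) M'"
        using ab by (auto intro: has_direction_scaled[OF M(1), of _ _ \<alpha>]
            has_direction_scaled[OF M(2), of _ _ \<beta>])
      then show ?thesis
        unfolding E using equal_conjugate_directions_affine_circle[OF gh] balanced[OF k ab] by blast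
    qed
    have "has_direction 0 (e + f) M\<^sub>1 \<and> has_direction 0 (e - f) M\<^sub>2 \<or>
        has_direction 0 (e - f) M\<^sub>1 \<and> has_direction 0 (e + f) M\<^sub>2"
    proof (rule common_conjugate_directions[OF area])
      fix k :: real assume "\<bar>k\<bar> < 1"
      then have "circumscribed_ellipse R (conic k)" using circ_iff by blast
      then show "conjugate_directions (vertex_conic z e f s t k) M\<^sub>1 M\<^sub>2"
        unfolding conic_def[symmetric] by (rule assms(3))
    qed
    then show ?thesis using * equal_conjugate_directions_commute by blast
  qed
  have less: "eccentricity (conic k0) < eccentricity (conic k)" if k: "\<bar>k\<bar> < 1" "k \<noteq> k0" for k
  proof -
    obtain c \<alpha> \<beta> where E: "conic k = affine_circle c (\<alpha> *\<^sub>R (e + f)) (\<beta> *\<^sub>R (e - f))"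
      and ab: "\<alpha> > 0" "\<beta> > 0" "(1 + k) * \<alpha>\<^sup>2 = (1 - k) * \<beta>\<^sup>2" using param[OF k(1)] by blast
    obtain c' \<alpha>' \<beta>' where E': "conic k0 = affine_circle c' (\<alpha>' *\<^sub>R (e + f)) (\<beta>' *\<^sub>R (e - f))"
      and ab': "\<alpha>' > 0" "\<beta>' > 0" "(1 + k0) * \<alpha>'\<^sup>2 = (1 - k0) * \<beta>'\<^sup>2" using param[OF k0] by blast
    have eq: "norm (\<alpha>' *\<^sub>R (e + f)) = norm (\<beta>' *\<^sub>R (e - f))"
      using balanced[OF k0 ab'] by (rule iffD2) (rule refl)
    have ne: "norm (\<alpha> *\<^sub>R (e + f)) \<noteq> norm (\<beta> *\<^sub>R (e - f))"
      unfolding balanced[OF k(1) ab] by (rule k(2))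
    show ?thesis unfolding E E'
      by (rule eccentricity_less_if_equal[OF GH ab(1,2) ab'(1,2) eq ne])
  qed
  show ?thesis
  proof (intro exI[of _ "conic k0"] conjI allI impI)
    show "circumscribed_ellipse R (conic k0)" using circ_iff k0 by blast
    show "equal_conjugate_directions (conic k0) M\<^sub>1 M\<^sub>2" using equal_iff[OF k0] by simp
    show "is_arg_min eccentricity (circumscribed_ellipse R) (conic k0)"
      unfolding is_arg_min_def
    proof (intro conjI notI)
      show "circumscribed_ellipse R (conic k0)" using circ_iff k0 by blast
    next
      assume "\<exists>E. circumscribed_ellipse R E \<and> eccentricity E < eccentricity (conic k0)"
      then obtain E where E: "circumscribed_ellipse R E" "eccentricity E < eccentricity (conic k0)"
        by (elim exE conjE)
      obtain k where k: "\<bar>k\<bar> < 1" "E = conic k" using E(1) circ_iff by blast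
      have lt: "eccentricity (conic k) < eccentricity (conic k0)" using E(2) unfolding k(2) .
      have "k \<noteq> k0" using lt by (metis less_irrefl)
      from less[OF k(1) this] lt show False by (rule less_asym)
    qed
  next
    fix E assume E: "circumscribed_ellipse R E \<and> equal_conjugate_directions E M\<^sub>1 M\<^sub>2"
    then obtain k where k: "\<bar>k\<bar> < 1" "E = conic k" using circ_iff by blast
    show "E = conic k0" using E equal_iff[OF k(1)] unfolding k(2) by simp
  next
    fix E assume "is_arg_min eccentricity (circumscribed_ellipse R) E"
    then have E: "circumscribed_ellipse R E"
      and least: "\<not> (\<exists>E'. circumscribed_ellipse R E' \<and> eccentricity E' < eccentricity E)"
      unfolding is_arg_min_def by (rule conjunct1, rule conjunct2)
    obtain k where k: "\<bar>k\<bar> < 1" "E = conic k" using E circ_iff by blast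
    have "circumscribed_ellipse R (conic k0)" using circ_iff k0 by blast
    then have "\<not> eccentricity (conic k0) < eccentricity E" using least by blast
    then have "k = k0" using less[OF k(1)] unfolding k(2) by (rule contrapos_np)
    then show "E = conic k0" unfolding k(2) by (rule arg_cong)
  qed
qed

end
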